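(* Let $n\ge 2$ be an integer. For every $L\ge 1$ and $c>0$ there is a constant $0<C=C(L,c)\le 1$ such that the following holds. Let $X$ and $Y$ be metric spaces of locally finite Hausdorff $n$-measure, and assume that $$\mathcal H^n(B(x,r))\ge c\,r^n\quad\text{for every } x\in X \text{ and } 0<r<\operatorname{diam}(X).$$ If $f\colon X\to Y$ is a volume-preserving $L$-Lipschitz map, then $$C\,\ell(\gamma)\le \ell(f\circ\gamma)\le L\,\ell(\gamma)$$ holds for almost every curve $\gamma$ in $X$.
   Context: $\mathcal H^n$ denotes the Hausdorff $n$-measure, normalized so that it agrees with Lebesgue measure on open subsets of $\mathbb R^n$. "Locally finite" means finite on compact subsets. $B(x,r)$ is the open ball of radius $r$ centered at $x$. A map $f\colon X\to Y$ is volume-preserving if $\mathcal H^n_Y(f(A))=\mathcal H^n_X(A)$ for every measurable set $A\subset X$. A curve in $X$ is a continuous map $\gamma\colon I\to X$ from an interval $I\subset\mathbb R$; $|\gamma|=\gamma(I)$ is its image and $\ell(\gamma)$ its length (total variation). It is rectifiable if $\ell(\gamma)<\infty$. A family $\Gamma_0$ of rectifiable curves in $X$ is exceptional if there is a set $A\subset X$ with $\mathcal H^n(A)=0$ such that $\mathcal H^1(|\gamma|\cap A)>0$ for every $\gamma\in\Gamma_0$. A property holds for almost every curve in $X$ if the family of (rectifiable) curves in $X$ for which it fails is exceptional.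
   Formalization: Y is also assumed to be a countable union of open sets of finite Hausdorff n-measure; without this the claim fails (e.g. for non-separable spaces). C is stated for fixed underlying types, which suffices since X and Y are then separable. *)

theory Defs
  imports "HOL-Analysis.Analysis"
begin

text \<open>
  A metric space is an element \<open>X :: 'a metric\<close>, with carrier \<^term>\<open>mspace X\<close> and distance
  \<^term>\<open>mdist X\<close>, so that one constant can be quantified before all spaces. (A type class
  rendering would only give a constant depending on the space.)
\<close>

text \<open>Unlike the library's real-valued \<^const>\<open>diameter\<close>, this is \<open>\<infinity>\<close> on unbounded sets.\<close>

definition ediam :: "'a metric \<Rightarrow> 'a set \<Rightarrow> ennreal" where
  "ediam X S = (SUP x\<in>S. SUP y\<in>S. ennreal (mdist X x y))"

text \<open>
  The infimum over an empty family of coverings is \<open>\<infinity>\<close>. The factor \<open>\<omega>\<^sub>n / 2\<^sup>n\<close>, where \<open>\<omega>\<^sub>n\<close> is the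
  volume of the unit ball of \<open>\<real>\<^sup>n\<close>, is the one for which the measure agrees with Lebesgue
  measure on \<open>\<real>\<^sup>n\<close>. The case distinction on \<open>E i = {}\<close> only matters for \<open>n = 0\<close>.
\<close>

definition hausdorff_content :: "'a metric \<Rightarrow> nat \<Rightarrow> real \<Rightarrow> 'a set \<Rightarrow> ennreal" where
  "hausdorff_content X n \<delta> A =
     (INF E \<in> {E :: nat \<Rightarrow> 'a set.
                (\<forall>i. E i \<subseteq> mspace X \<and> ediam X (E i) < ennreal \<delta>) \<and> A \<subseteq> (\<Union>i. E i)}.
        \<Sum>i. ennreal (unit_ball_vol (real n) / 2 ^ n) *
             (if E i = {} then 0 else ediam X (E i) ^ n))"

definition hausdorff_measure :: "'a metric \<Rightarrow> nat \<Rightarrow> 'a set \<Rightarrow> ennreal" where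
  "hausdorff_measure X n A = (SUP \<delta>\<in>{0<..}. hausdorff_content X n \<delta> A)"

text \<open>Measurability is meant in the sense of Caratheodory, for the outer measure above.\<close>

definition hausdorff_sets :: "'a metric \<Rightarrow> nat \<Rightarrow> 'a set set" where
  "hausdorff_sets X n = lambda_system (mspace X) (Pow (mspace X)) (hausdorff_measure X n)"

definition locally_finite_hausdorff :: "'a metric \<Rightarrow> nat \<Rightarrow> bool" where
  "locally_finite_hausdorff X n \<longleftrightarrow>
     (\<forall>K. compactin (mtopology_of X) K \<longrightarrow> hausdorff_measure X n K < \<infinity>)"

text \<open>
  For a separable locally compact \<open>X\<close> this follows from \<^prop>\<open>locally_finite_hausdorff X n\<close>.
  In general finiteness on compact sets neither gives small balls finite measure nor makes the
  space separable, and without these a statement about almost every curve fails. Example: let \<open>U\<close>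
  be the set of finitely supported sequences \<open>\<nat> \<rightarrow> \<real>\<close>, with distance \<open>1 / (1 + k)\<close> between
  sequences that first differ at index \<open>k\<close>. Compact sets in \<open>U\<close> are countable, and a subset of
  \<open>[0,1] \<times> U\<close> or of \<open>U\<close> has infinite \<open>n\<close>-measure if its projection to \<open>U\<close> is uncountable, and
  measure zero otherwise (\<open>n \<ge> 2\<close>). So the projection \<open>[0,1] \<times> U \<rightarrow> U\<close> is 1-Lipschitz and
  volume-preserving, both spaces have finite measure on compact sets, all balls have infinite
  measure, and yet the segments \<open>[0,1] \<times> {u}\<close>, which the projection collapses, do not form an
  exceptional family.
\<close>

definition open_sigma_finite_hausdorff :: "'a metric \<Rightarrow> nat \<Rightarrow> bool" where
  "open_sigma_finite_hausdorff X n \<longleftrightarrow>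
     (\<exists>V :: nat \<Rightarrow> 'a set. (\<forall>i. openin (mtopology_of X) (V i) \<and> hausdorff_measure X n (V i) < \<infinity>)
        \<and> (\<Union>i. V i) = mspace X)"

definition lipschitz_map :: "real \<Rightarrow> 'a metric \<Rightarrow> 'b metric \<Rightarrow> ('a \<Rightarrow> 'b) \<Rightarrow> bool" where
  "lipschitz_map L X Y f \<longleftrightarrow>
     f \<in> mspace X \<rightarrow> mspace Y \<and>
     (\<forall>x\<in>mspace X. \<forall>y\<in>mspace X. mdist Y (f x) (f y) \<le> L * mdist X x y)"

definition volume_preserving :: "nat \<Rightarrow> 'a metric \<Rightarrow> 'b metric \<Rightarrow> ('a \<Rightarrow> 'b) \<Rightarrow> bool" where
  "volume_preserving n X Y f \<longleftrightarrow>
     (\<forall>A\<in>hausdorff_sets X n. hausdorff_measure Y n (f ` A) = hausdorff_measure X n A)"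

text \<open>
  A curve is an interval \<open>I\<close> of any kind together with a function of which only the values
  on \<open>I\<close> matter.
\<close>

definition curve_in :: "'a metric \<Rightarrow> real set \<Rightarrow> (real \<Rightarrow> 'a) \<Rightarrow> bool" where
  "curve_in X I \<gamma> \<longleftrightarrow> is_interval I \<and> continuous_map (top_of_set I) (mtopology_of X) \<gamma>"

definition curve_length :: "'a metric \<Rightarrow> real set \<Rightarrow> (real \<Rightarrow> 'a) \<Rightarrow> ennreal" where
  "curve_length X I \<gamma> =
     (SUP ts \<in> {ts. sorted ts \<and> set ts \<subseteq> I}.
        \<Sum>i<length ts - 1. ennreal (mdist X (\<gamma> (ts ! i)) (\<gamma> (ts ! Suc i))))"

definition rectifiable_curve :: "'a metric \<Rightarrow> real set \<Rightarrow> (real \<Rightarrow> 'a) \<Rightarrow> bool" where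
  "rectifiable_curve X I \<gamma> \<longleftrightarrow> curve_in X I \<gamma> \<and> curve_length X I \<gamma> < \<infinity>"

definition exceptional :: "'a metric \<Rightarrow> nat \<Rightarrow> (real set \<times> (real \<Rightarrow> 'a)) set \<Rightarrow> bool" where
  "exceptional X n \<Gamma> \<longleftrightarrow>
     (\<exists>A\<subseteq>mspace X. hausdorff_measure X n A = 0 \<and>
        (\<forall>(I, \<gamma>)\<in>\<Gamma>. hausdorff_measure X 1 (\<gamma> ` I \<inter> A) > 0))"

definition almost_every_curve ::
    "'a metric \<Rightarrow> nat \<Rightarrow> (real set \<Rightarrow> (real \<Rightarrow> 'a) \<Rightarrow> bool) \<Rightarrow> bool" where
  "almost_every_curve X n P \<longleftrightarrow> exceptional X n {(I, \<gamma>). rectifiable_curve X I \<gamma> \<and> \<not> P I \<gamma>}"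

end

theory Submission
  imports Defs
begin

text \<open>
  The density of \<open>\<H>\<^sup>n\<close> in \<open>Y\<close> is bounded: outside a null \<open>G\<^sub>\<delta>\<close> set \<open>N\<close>, every small ball around \<open>y\<close> of
  radius \<open>r\<close> has measure at most \<open>K r\<^sup>n\<close>, with \<open>K\<close> depending only on \<open>n\<close>. As \<open>f\<close> preserves volume,
  \<open>A = f\<^sup>-\<^sup>1(N)\<close> is null. Let \<open>\<gamma>\<close> pass through \<open>x \<notin> A\<close>. If the image of a short
  subcurve through \<open>x\<close> lies in \<open>B(f(x), r)\<close> while the subcurve has diameter at least \<open>2Mr\<close>, there are
  \<open>M + 1\<close> disjoint balls of radius \<open>r\<close> centred on it. Their total measure is at least \<open>(M + 1) c r\<^sup>n\<close>,
  and it is preserved by \<open>f\<close>, which maps them into \<open>B(f(x), (L + 1) r)\<close>; this bounds \<open>M\<close>. Hence near such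
  points the diameter of a subcurve is at most \<open>2M\<close> times the length of its image. If
  \<open>\<H>\<^sup>1(|\<gamma>| \<inter> A) = 0\<close>, the function \<open>d(\<gamma>(a), \<gamma>(t))\<close> maps the remaining parameters to a set of
  measure zero, so the local bound gives \<open>d(\<gamma>(a), \<gamma>(b)) \<le> 2M \<ell>(f \<circ> \<gamma>|[a,b])\<close>. Summing over
  partitions concludes.
\<close>

section \<open>Hausdorff measure as a metric outer measure\<close>

lemma openin_mtopology_of:
  "openin (mtopology_of X) U \<longleftrightarrow> U \<subseteq> mspace X \<and> (\<forall>x\<in>U. \<exists>r>0. mball_of X x r \<subseteq> U)"
  by (auto simp: mtopology_of_def mball_of_def Metric_space.openin_mtopology)

lemma openin_mball_of: "openin (mtopology_of X) (mball_of X x r)"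
  by (simp add: mtopology_of_def mball_of_def Metric_space.openin_mball)

lemma mdist_self: "x \<in> mspace X \<Longrightarrow> mdist X x x = 0"
  by simp

lemma mdist_le_ediam: "x \<in> S \<Longrightarrow> y \<in> S \<Longrightarrow> ennreal (mdist X x y) \<le> ediam X S"
  unfolding ediam_def by (meson SUP_upper2 order_refl)

lemma ediam_le: "(\<And>x y. x \<in> S \<Longrightarrow> y \<in> S \<Longrightarrow> ennreal (mdist X x y) \<le> d) \<Longrightarrow> ediam X S \<le> d"
  unfolding ediam_def by (intro SUP_least)

lemma ediam_empty [simp]: "ediam X {} = 0"
  by (simp add: ediam_def bot_ennreal)

section \<open>Covers, Hausdorff content and the outer measure\<close>

definition hausdorff_weight :: "'a metric \<Rightarrow> nat \<Rightarrow> 'a set \<Rightarrow> ennreal" where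
  "hausdorff_weight X n E =
     ennreal (unit_ball_vol (real n) / 2 ^ n) * (if E = {} then 0 else ediam X E ^ n)"

definition small_cover :: "'a metric \<Rightarrow> real \<Rightarrow> 'a set \<Rightarrow> (nat \<Rightarrow> 'a set) \<Rightarrow> bool" where
  "small_cover X \<delta> A E \<longleftrightarrow>
     (\<forall>i. E i \<subseteq> mspace X \<and> ediam X (E i) < ennreal \<delta>) \<and> A \<subseteq> (\<Union>i. E i)"

lemma hausdorff_weight_empty [simp]: "hausdorff_weight X n {} = 0"
  by (simp add: hausdorff_weight_def)

lemma hausdorff_content_alt:
  "hausdorff_content X n \<delta> A = (INF E \<in> Collect (small_cover X \<delta> A). \<Sum>i. hausdorff_weight X n (E i))"
  unfolding hausdorff_content_def hausdorff_weight_def small_cover_def ..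

lemma hausdorff_content_le:
  "small_cover X \<delta> A E \<Longrightarrow> hausdorff_content X n \<delta> A \<le> (\<Sum>i. hausdorff_weight X n (E i))"
  unfolding hausdorff_content_alt by (rule INF_lower) simp

lemma hausdorff_content_greatest:
  "(\<And>E. small_cover X \<delta> A E \<Longrightarrow> z \<le> (\<Sum>i. hausdorff_weight X n (E i)))
    \<Longrightarrow> z \<le> hausdorff_content X n \<delta> A"
  unfolding hausdorff_content_alt by (rule INF_greatest) simp

text \<open>The infimum over covers need not be attained. Finiteness makes adding
  \<open>ennreal e\<close> a strict increase, so some cover lies below the increased value.\<close>

lemma hausdorff_content_approx:
  assumes "hausdorff_content X n \<delta> A < \<infinity>" "e > 0"
  obtains E where "small_cover X \<delta> A E"
    "(\<Sum>i. hausdorff_weight X n (E i)) \<le> hausdorff_content X n \<delta> A + ennreal e"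
proof -
  have "hausdorff_content X n \<delta> A + 0 < hausdorff_content X n \<delta> A + ennreal e"
    unfolding ennreal_add_left_cancel_less using assms by auto
  then have "(INF E \<in> Collect (small_cover X \<delta> A). \<Sum>i. hausdorff_weight X n (E i))
      < hausdorff_content X n \<delta> A + ennreal e"
    by (simp only: hausdorff_content_alt[symmetric] add_0_right)
  then obtain E where "small_cover X \<delta> A E"
    "(\<Sum>i. hausdorff_weight X n (E i)) < hausdorff_content X n \<delta> A + ennreal e"
    unfolding INF_less_iff by blast
  then show thesis
    using that[of E] by simp
qed

lemma hausdorff_content_mono: "A \<subseteq> B \<Longrightarrow> hausdorff_content X n \<delta> A \<le> hausdorff_content X n \<delta> B"
  by (rule hausdorff_content_greatest, rule hausdorff_content_le) (auto simp: small_cover_def)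

lemma hausdorff_content_antimono:
  assumes "\<delta> \<le> \<delta>'"
  shows "hausdorff_content X n \<delta>' A \<le> hausdorff_content X n \<delta> A"
proof (rule hausdorff_content_greatest, rule hausdorff_content_le)
  fix E assume "small_cover X \<delta> A E"
  then show "small_cover X \<delta>' A E"
    using assms by (auto simp: small_cover_def intro: less_le_trans ennreal_leI)
qed

lemma hausdorff_content_le_measure:
  "\<delta> > 0 \<Longrightarrow> hausdorff_content X n \<delta> A \<le> hausdorff_measure X n A"
  unfolding hausdorff_measure_def by (rule SUP_upper) simp

lemma hausdorff_measure_least:
  "(\<And>\<delta>. \<delta> > 0 \<Longrightarrow> hausdorff_content X n \<delta> A \<le> z) \<Longrightarrow> hausdorff_measure X n A \<le> z"
  unfolding hausdorff_measure_def by (rule SUP_least) simp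

lemma hausdorff_measure_mono: "A \<subseteq> B \<Longrightarrow> hausdorff_measure X n A \<le> hausdorff_measure X n B"
  by (meson hausdorff_content_le_measure hausdorff_content_mono hausdorff_measure_least order_trans)

lemma hausdorff_measure_empty [simp]: "hausdorff_measure X n {} = 0"
proof -
  have "hausdorff_content X n \<delta> {} \<le> 0" if "\<delta> > 0" for \<delta>
    using hausdorff_content_le[of X \<delta> "{}" "\<lambda>_. {}" n] that by (simp add: small_cover_def)
  then show ?thesis
    by (metis hausdorff_measure_least le_zero_eq)
qed

text \<open>Take a cover of each \<open>A i\<close> that is optimal up to \<open>e / 2^(i+1)\<close>
  and list all their members as one sequence through \<open>prod_decode\<close>; the errors add up
  to \<open>e\<close>. If one content is infinite there is nothing to prove.\<close>

lemma hausdorff_content_UN: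
  "hausdorff_content X n \<delta> (\<Union>i. A i) \<le> (\<Sum>i. hausdorff_content X n \<delta> (A (i::nat)))"
proof (cases "\<forall>i. hausdorff_content X n \<delta> (A i) < \<infinity>")
  case True
  show ?thesis
  proof (rule ennreal_le_epsilon)
    fix e :: real assume e: "e > 0"
    have "\<exists>E. small_cover X \<delta> (A i) E \<and> (\<Sum>j. hausdorff_weight X n (E j))
        \<le> hausdorff_content X n \<delta> (A i) + ennreal (e * (1/2) ^ Suc i)" for i
      using hausdorff_content_approx[of X n \<delta> "A i" "e * (1/2) ^ Suc i"] True e by auto
    then obtain E where E: "\<And>i. small_cover X \<delta> (A i) (E i)"
      "\<And>i. (\<Sum>j. hausdorff_weight X n (E i j))
        \<le> hausdorff_content X n \<delta> (A i) + ennreal (e * (1/2) ^ Suc i)"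
      by metis
    let ?F = "\<lambda>k. case_prod E (prod_decode k)"
    have "(\<Union>i. A i) \<subseteq> (\<Union>k. ?F k)"
    proof
      fix x assume "x \<in> (\<Union>i. A i)"
      then obtain i j where "x \<in> E i j"
        using E(1) unfolding small_cover_def by blast
      then have "x \<in> ?F (prod_encode (i, j))" by simp
      then show "x \<in> (\<Union>k. ?F k)" by (rule UN_I[OF UNIV_I])
    qed
    moreover have "?F k \<subseteq> mspace X \<and> ediam X (?F k) < ennreal \<delta>" for k
      using E(1) by (cases "prod_decode k") (simp add: small_cover_def)
    ultimately have "small_cover X \<delta> (\<Union>i. A i) ?F"
      unfolding small_cover_def by blast
    then have "hausdorff_content X n \<delta> (\<Union>i. A i) \<le> (\<Sum>k. hausdorff_weight X n (?F k))"
      by (rule hausdorff_content_le)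
    also have "\<dots> = (\<Sum>k. (\<lambda>(i,j). hausdorff_weight X n (E i j)) (prod_decode k))"
      by (intro suminf_cong) (auto split: prod.split)
    also have "\<dots> = (\<Sum>i. \<Sum>j. hausdorff_weight X n (E i j))"
      by (rule suminf_ennreal_2dimen) simp
    also have "\<dots> \<le> (\<Sum>i. hausdorff_content X n \<delta> (A i) + ennreal (e * (1/2) ^ Suc i))"
      by (intro suminf_le allI E(2)) auto
    also have "\<dots> = (\<Sum>i. hausdorff_content X n \<delta> (A i)) + (\<Sum>i. ennreal (e * (1/2) ^ Suc i))"
      by (subst suminf_add) auto
    also have "(\<Sum>i. ennreal (e * (1/2) ^ Suc i)) = ennreal e"
      using e sums_mult[OF power_half_series, of e]
      by (intro suminf_ennreal_eq) (auto simp del: power_Suc)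
    finally show "hausdorff_content X n \<delta> (\<Union>i. A i) \<le> (\<Sum>i. hausdorff_content X n \<delta> (A i)) + ennreal e" .
  qed
next
  case False
  then obtain i where "hausdorff_content X n \<delta> (A i) = \<infinity>"
    by (metis infinity_ennreal_def less_top)
  then have "(\<Sum>i. hausdorff_content X n \<delta> (A i)) = \<infinity>"
    using sum_le_suminf[of "\<lambda>i. hausdorff_content X n \<delta> (A i)" "{i}"] by (auto simp: top_unique)
  then show ?thesis by simp
qed

lemma hausdorff_measure_UN:
  "hausdorff_measure X n (\<Union>i. A i) \<le> (\<Sum>i. hausdorff_measure X n (A (i::nat)))"
proof (rule hausdorff_measure_least)
  fix \<delta> :: real assume "\<delta> > 0"
  then show "hausdorff_content X n \<delta> (\<Union>i. A i) \<le> (\<Sum>i. hausdorff_measure X n (A i))"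
    by (intro order_trans[OF hausdorff_content_UN] suminf_le hausdorff_content_le_measure) auto
qed

lemma hausdorff_measure_Un:
  "hausdorff_measure X n (A \<union> B) \<le> hausdorff_measure X n A + hausdorff_measure X n B"
proof -
  have "hausdorff_measure X n (A \<union> B) \<le> (\<Sum>i. hausdorff_measure X n (binaryset A B i))"
    using hausdorff_measure_UN[of X n "binaryset A B"] by (simp add: UN_binaryset_eq)
  also have "\<dots> = hausdorff_measure X n A + hausdorff_measure X n B"
    by (rule suminf_binaryset_eq) simp
  finally show ?thesis .
qed

text \<open>A covering set of diameter below \<open>d\<close> cannot meet both \<open>A\<close> and
  \<open>B\<close>, so a fine cover of the union splits into a cover of \<open>A\<close> and a
  disjoint selection covering \<open>B\<close>.\<close>

lemma hausdorff_measure_separated: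
  assumes "d > 0" and sep: "\<And>x y. x \<in> A \<Longrightarrow> y \<in> B \<Longrightarrow> d \<le> mdist X x y"
  shows "hausdorff_measure X n A + hausdorff_measure X n B \<le> hausdorff_measure X n (A \<union> B)"
proof -
  have *: "hausdorff_content X n \<delta> A + hausdorff_content X n \<delta>' B \<le> hausdorff_measure X n (A \<union> B)"
    if "\<delta> > 0" "\<delta>' > 0" for \<delta> \<delta>'
  proof -
    \<comment> \<open>One scale serves three purposes: it is below \<open>d\<close>, and since
      content grows as the scale shrinks, the contents at \<open>\<delta>\<close> and
      \<open>\<delta>'\<close> are bounded by those at \<open>\<eta>\<close>.\<close>
    define \<eta> where "\<eta> = min d (min \<delta> \<delta>')"
    have \<eta>: "\<eta> > 0" "\<eta> \<le> \<delta>" "\<eta> \<le> \<delta>'" "\<eta> \<le> d" using that assms by (auto simp: \<eta>_def)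
    have "hausdorff_content X n \<eta> A + hausdorff_content X n \<eta> B \<le> hausdorff_content X n \<eta> (A \<union> B)"
    proof (rule hausdorff_content_greatest)
      fix E assume E: "small_cover X \<eta> (A \<union> B) E"
      \<comment> \<open>Members that miss \<open>C\<close> become empty rather than being dropped:
        the indexing stays the same and an empty set has weight zero.\<close>
      define F where "F = (\<lambda>C i. if E i \<inter> C = {} then {} else E i)"
      have F: "small_cover X \<eta> C (F C)" if "C \<subseteq> A \<union> B" for C
      proof -
        have "ediam X (F C i) < ennreal \<eta>" "F C i \<subseteq> mspace X" for i
          using E \<eta>(1) by (auto simp: small_cover_def F_def)
        moreover have "C \<subseteq> (\<Union>i. F C i)"
        proof
          fix x assume "x \<in> C"
          then have "x \<in> (\<Union>i. E i)" using E that unfolding small_cover_def by blast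
          then obtain i where "x \<in> E i" by blast
          then have "x \<in> F C i" using \<open>x \<in> C\<close> by (auto simp: F_def)
          then show "x \<in> (\<Union>i. F C i)" by blast
        qed
        ultimately show ?thesis by (auto simp: small_cover_def)
      qed
      have disj: "E i \<inter> A = {} \<or> E i \<inter> B = {}" for i
      proof (rule ccontr)
        assume "\<not> ?thesis"
        then obtain x y where xy: "x \<in> E i" "y \<in> E i" "x \<in> A" "y \<in> B" by blast
        have "ennreal (mdist X x y) < ennreal \<eta>"
          using mdist_le_ediam[OF xy(1,2)] E by (meson le_less_trans small_cover_def)
        then show False using sep[OF xy(3,4)] \<eta> by (simp add: ennreal_less_iff)
      qed
      have "hausdorff_content X n \<eta> A + hausdorff_content X n \<eta> B
          \<le> (\<Sum>i. hausdorff_weight X n (F A i)) + (\<Sum>i. hausdorff_weight X n (F B i))"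
        by (intro add_mono hausdorff_content_le F) auto
      also have "\<dots> = (\<Sum>i. hausdorff_weight X n (F A i) + hausdorff_weight X n (F B i))"
        by (rule suminf_add) auto
      also have "\<dots> \<le> (\<Sum>i. hausdorff_weight X n (E i))"
        using disj by (intro suminf_le) (auto simp: F_def)
      finally show "hausdorff_content X n \<eta> A + hausdorff_content X n \<eta> B
        \<le> (\<Sum>i. hausdorff_weight X n (E i))" .
    qed
    then show ?thesis
      using \<eta> by (meson add_mono hausdorff_content_antimono hausdorff_content_le_measure order_trans)
  qed
  \<comment> \<open>The two measures are suprema over independent scales, which is why
    \<open>*\<close> allows two different ones.\<close>
  have "hausdorff_measure X n A + hausdorff_measure X n B
      = (SUP \<delta>\<in>{0<..}. SUP \<delta>'\<in>{0<..}. hausdorff_content X n \<delta> A + hausdorff_content X n \<delta>' B)"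
    unfolding hausdorff_measure_def
    by (subst ennreal_SUP_add_left[symmetric], simp, subst ennreal_SUP_add_right) auto
  also have "\<dots> \<le> hausdorff_measure X n (A \<union> B)"
    by (intro SUP_least *) auto
  finally show ?thesis .
qed

section \<open>Open sets are Caratheodory measurable\<close>

lemma sum_lessThan_even_odd:
  fixes f :: "nat \<Rightarrow> 'a::comm_monoid_add"
  shows "(\<Sum>i<2*m. f i) = (\<Sum>i<m. f (2*i)) + (\<Sum>i<m. f (Suc (2*i)))"
  by (induction m) (simp_all add: algebra_simps)

lemma ennreal_suminf_tail_less:
  fixes f :: "nat \<Rightarrow> ennreal"
  assumes "(\<Sum>i. f i) < \<infinity>" "e > 0"
  shows "\<exists>k. (\<Sum>i. f (i + k)) \<le> ennreal e"
proof -
  have fin: "f i < top" for i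
    using assms(1) sum_le_suminf[of f "{i}"] by (auto simp: less_top[symmetric] top_unique)
  define r where "r i = enn2real (f i)" for i
  have f: "f i = ennreal (r i)" for i
    using fin[of i] by (simp add: r_def)
  have r: "r i \<ge> 0" for i by (simp add: r_def)
  have sr: "summable r"
    using assms(1) r by (intro summable_suminf_not_top) (auto simp: f less_top)
  obtain k where "norm (\<Sum>i. r (i + k)) < e"
    using suminf_exist_split[OF assms(2) sr] by blast
  moreover have "(\<Sum>i. f (i + k)) = ennreal (\<Sum>i. r (i + k))"
    unfolding f using r sr by (intro suminf_ennreal2) (auto simp: summable_iff_shift)
  ultimately show ?thesis
    by (intro exI[of _ k]) (auto intro!: ennreal_leI)
qed

text \<open>
  Caratheodory's criterion: \<open>T \<inter> U\<close> is exhausted by the sets of points at depth \<open>1/(k+1)\<close> in \<open>U\<close>.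
  The differences of consecutive ones, taken two apart, are separated; so their measures
  are summable.
\<close>

lemma openin_hausdorff_sets:
  assumes U: "openin (mtopology_of X) U"
  shows "U \<in> hausdorff_sets X n"
proof -
  interpret sigma_algebra "mspace X" "Pow (mspace X)" by (rule sigma_algebra_Pow)
  let ?H = "hausdorff_measure X n"
  have UX: "U \<subseteq> mspace X" using U by (simp add: openin_mtopology_of)
  have "?H (T \<inter> U) + ?H (T - U) \<le> ?H T" if T: "T \<subseteq> mspace X" and fin: "?H T < \<infinity>" for T
  proof -
    define D where "D k = {x \<in> T \<inter> U. mball_of X x (1 / real (Suc k)) \<subseteq> U}" for k
    define R where "R k = D (Suc k) - D k" for k
    have D_mono: "D j \<subseteq> D k" if "j \<le> k" for j k
    proof -
      have "1 / real (Suc k) \<le> 1 / real (Suc j)" using that by (simp add: field_simps)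
      then show ?thesis unfolding D_def by (fastforce intro: less_le_trans)
    qed
    \<comment> \<open>A point of \<open>D k\<close> has distance at least \<open>1/(k+1)\<close>
      from every point outside \<open>U\<close>, while \<open>y\<close> either lies outside
      \<open>U\<close> or is within \<open>1/(k+2)\<close> of such a point. The triangle inequality
      gives the gap.\<close>
    have sep: "1 / real (Suc k) - 1 / real (Suc (Suc k)) \<le> mdist X x y"
      if x: "x \<in> D k" and y: "y \<in> T - D (Suc k)" for x y k
    proof -
      have far: "1 / real (Suc k) \<le> mdist X x z" if "z \<in> mspace X" "z \<notin> U" for z
        using x that T by (force simp: D_def)
      show ?thesis
      proof (cases "y \<in> U")
        case True
        then have "\<not> mball_of X y (1 / real (Suc (Suc k))) \<subseteq> U"
          using y unfolding D_def by blast
        then obtain z where z: "z \<in> mspace X" "z \<notin> U" "mdist X y z < 1 / real (Suc (Suc k))"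
          unfolding subset_iff in_mball_of by blast
        have "x \<in> mspace X" "y \<in> mspace X" using x y T by (auto simp: D_def)
        then show ?thesis
          using far[OF z(1,2)] mdist_triangle[of x X y z] z by linarith
      next
        case False
        then show ?thesis
          using far[of y] y T by (simp add: diff_le_eq order.trans subset_iff)
      qed
    qed
    have add: "?H A + ?H B \<le> ?H (A \<union> B)" if "A \<subseteq> D k" "B \<subseteq> T - D (Suc k)" for A B k
    proof (rule hausdorff_measure_separated)
      show "0 < 1 / real (Suc k) - 1 / real (Suc (Suc k))" by (simp add: field_simps add_pos_nonneg)
      show "1 / real (Suc k) - 1 / real (Suc (Suc k)) \<le> mdist X x y" if "x \<in> A" "y \<in> B" for x y
        using sep[of x k y] that \<open>A \<subseteq> D k\<close> \<open>B \<subseteq> T - D (Suc k)\<close> by blast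
    qed
    \<comment> \<open>Here \<open>p\<close> is the parity. For \<open>m > 0\<close> the layers with
      \<open>i < m\<close> lie in \<open>D (2*m+p-1)\<close> and the next one avoids
      \<open>D (2*m+p)\<close>, so \<open>add\<close> applies at each step of the induction.\<close>
    have half: "(\<Sum>i<m. ?H (R (2 * i + p))) \<le> ?H T" for m p
    proof -
      have "(\<Sum>i<m. ?H (R (2 * i + p))) \<le> ?H (\<Union>i<m. R (2 * i + p))"
      proof (induction m)
        case (Suc m)
        have "?H (\<Union>i<m. R (2 * i + p)) + ?H (R (2 * m + p)) \<le> ?H ((\<Union>i<m. R (2 * i + p)) \<union> R (2 * m + p))"
        proof (cases m)
          case (Suc l)
          have "R (2 * i + p) \<subseteq> D (2 * l + p + 1)" if "i < m" for i
            using D_mono[of "Suc (2 * i + p)" "2 * l + p + 1"] that Suc by (auto simp: R_def)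
          moreover have "R (2 * m + p) \<subseteq> T - D (Suc (2 * l + p + 1))"
            using Suc by (auto simp: R_def D_def)
          ultimately show ?thesis by (intro add) auto
        qed simp
        with Suc show ?case
          by (auto simp: lessThan_Suc Un_commute add.commute intro: order_trans[OF add_left_mono])
      qed simp
      also have "\<dots> \<le> ?H T"
        by (rule hausdorff_measure_mono) (auto simp: R_def D_def)
      finally show ?thesis .
    qed
    have "(\<Sum>i<m. ?H (R i)) \<le> ?H T + ?H T" for m
    proof -
      have "(\<Sum>i<m. ?H (R i)) \<le> (\<Sum>i<2*m. ?H (R i))" by (rule sum_mono2) auto
      also have "\<dots> \<le> ?H T + ?H T"
        unfolding sum_lessThan_even_odd using half[of 0 m] half[of 1 m] by (simp add: add_mono)
      finally show ?thesis .
    qed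
    then have "(\<Sum>i. ?H (R i)) \<le> ?H T + ?H T" by (intro suminf_le_const) auto
    also have "\<dots> < \<infinity>" using fin by simp
    finally have R_fin: "(\<Sum>i. ?H (R i)) < \<infinity>" .
    show ?thesis
    proof (rule ennreal_le_epsilon)
      fix e :: real assume "e > 0"
      then obtain k where k: "(\<Sum>i. ?H (R (i + k))) \<le> ennreal e"
        using ennreal_suminf_tail_less[OF R_fin] by blast
      \<comment> \<open>As \<open>U\<close> is open, every point of \<open>T \<inter> U\<close> lies
        in some \<open>D l\<close>. For the least such \<open>l\<close>, either
        \<open>l \<le> k\<close> or the point is in the layer \<open>R (l-1)\<close>, which belongs
        to the tail of small total measure.\<close>
      have "T \<inter> U \<subseteq> D k \<union> (\<Union>i. R (i + k))"
      proof
        fix x assume x: "x \<in> T \<inter> U"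
        then obtain r where r: "r > 0" "mball_of X x r \<subseteq> U"
          using U by (auto simp: openin_mtopology_of)
        then obtain m where "1 / real (Suc m) < r"
          using reals_Archimedean by (metis inverse_eq_divide)
        then have "x \<in> D m" using r x by (auto simp: D_def)
        define l where "l = (LEAST m. x \<in> D m)"
        have l: "x \<in> D l" unfolding l_def using \<open>x \<in> D m\<close> by (rule LeastI)
        show "x \<in> D k \<union> (\<Union>i. R (i + k))"
        proof (cases "l \<le> k")
          case True then show ?thesis using l D_mono by blast
        next
          case False
          then have l': "Suc ((l - Suc k) + k) = l" by simp
          have "x \<notin> D ((l - Suc k) + k)"
            using not_less_Least[of "(l - Suc k) + k" "\<lambda>m. x \<in> D m"] l' unfolding l_def[symmetric] by simp
          then have "x \<in> R ((l - Suc k) + k)" unfolding R_def l' using l by simp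
          then show ?thesis by blast
        qed
      qed
      then have "?H (T \<inter> U) \<le> ?H (D k \<union> (\<Union>i. R (i + k)))" by (rule hausdorff_measure_mono)
      also have "\<dots> \<le> ?H (D k) + ?H (\<Union>i. R (i + k))" by (rule hausdorff_measure_Un)
      also have "\<dots> \<le> ?H (D k) + ennreal e"
        by (intro add_left_mono order_trans[OF hausdorff_measure_UN k])
      finally have "?H (T \<inter> U) + ?H (T - U) \<le> (?H (D k) + ?H (T - U)) + ennreal e"
        by (simp add: add_right_mono ac_simps)
      also have "?H (D k) + ?H (T - U) \<le> ?H (D k \<union> (T - U))"
        by (rule add[of _ k]) (auto simp: D_def)
      also have "\<dots> \<le> ?H T" by (rule hausdorff_measure_mono) (auto simp: D_def)
      finally show "?H (T \<inter> U) + ?H (T - U) \<le> ?H T + ennreal e" by (simp add: add_right_mono)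
    qed
  qed
  then have "?H (T \<inter> U) + ?H (T - U) = ?H T" if "T \<subseteq> mspace X" for T
    using that hausdorff_measure_Un[of X n "T \<inter> U" "T - U"]
    by (cases "?H T < \<infinity>") (auto simp: Int_Diff_Un less_top[symmetric] top_unique intro!: antisym)
  then show ?thesis
    unfolding hausdorff_sets_def lambda_system_eq using UX by blast
qed

section \<open>Hausdorff measure as a measure space\<close>

lemma outer_measure_space_hausdorff:
  "outer_measure_space (Pow (mspace X)) (hausdorff_measure X n)"
  unfolding outer_measure_space_def positive_def increasing_def countably_subadditive_def
  by (auto intro: hausdorff_measure_mono hausdorff_measure_UN)

text \<open>Packaging the outer measure with its Caratheodory sets makes additivity and continuity
  from above available through \<open>emeasure\<close>.\<close>

definition hausdorff_space :: "'a metric \<Rightarrow> nat \<Rightarrow> 'a measure" where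
  "hausdorff_space X n = measure_of (mspace X) (hausdorff_sets X n) (hausdorff_measure X n)"

lemma measure_space_hausdorff:
  "measure_space (mspace X) (hausdorff_sets X n) (hausdorff_measure X n)"
  unfolding hausdorff_sets_def
  by (rule sigma_algebra.caratheodory_lemma[OF sigma_algebra_Pow outer_measure_space_hausdorff])

lemma space_hausdorff_space [simp]: "space (hausdorff_space X n) = mspace X"
  unfolding hausdorff_space_def using measure_space_hausdorff[of X n]
  by (intro space_measure_of) (simp add: measure_space_def sigma_algebra_iff2)

lemma sets_hausdorff_space [simp]: "sets (hausdorff_space X n) = hausdorff_sets X n"
  unfolding hausdorff_space_def using measure_space_hausdorff[of X n]
  by (intro sigma_algebra.sets_measure_of_eq) (simp add: measure_space_def)

lemma emeasure_hausdorff_space [simp]: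
  "A \<in> hausdorff_sets X n \<Longrightarrow> emeasure (hausdorff_space X n) A = hausdorff_measure X n A"
  unfolding hausdorff_space_def using measure_space_hausdorff[of X n]
  by (intro emeasure_measure_of_sigma) (auto simp: measure_space_def)

section \<open>The density bound\<close>

text \<open>
  Zorn's lemma is applied to the disjoint families \<open>G\<close> such that every ball meeting some member
  of \<open>G\<close> meets one of at least half its radius.
\<close>

lemma Vitali_covering_5r:
  fixes F :: "('a \<times> real) set"
  assumes F: "\<And>p. p \<in> F \<Longrightarrow> fst p \<in> mspace X \<and> 0 < snd p \<and> snd p \<le> R"
  obtains G where "G \<subseteq> F"
    "pairwise (\<lambda>p q. disjnt (mball_of X (fst p) (snd p)) (mball_of X (fst q) (snd q))) G"
    "\<And>p. p \<in> F \<Longrightarrow> \<exists>q\<in>G. mball_of X (fst p) (snd p) \<subseteq> mball_of X (fst q) (5 * snd q)"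
proof -
  define B where "B p = mball_of X (fst p) (snd p)" for p :: "'a \<times> real"
  define \<Omega> where "\<Omega> = {G. G \<subseteq> F \<and> pairwise (\<lambda>p q. disjnt (B p) (B q)) G \<and>
    (\<forall>p\<in>F. \<forall>q\<in>G. \<not> disjnt (B p) (B q) \<longrightarrow> (\<exists>q\<in>G. \<not> disjnt (B p) (B q) \<and> snd p \<le> 2 * snd q))}"
  have "\<exists>G\<in>\<Omega>. \<forall>H\<in>\<Omega>. G \<subseteq> H \<longrightarrow> H = G"
  proof (rule subset_Zorn')
    fix C assume C: "subset.chain \<Omega> C"
    then have C\<Omega>: "C \<subseteq> \<Omega>" by (simp add: subset.chain_def)
    have "pairwise (\<lambda>p q. disjnt (B p) (B q)) (\<Union>C)"
      unfolding pairwise_def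
    proof (intro ballI impI)
      fix p q assume "p \<in> \<Union>C" "q \<in> \<Union>C" "p \<noteq> q"
      then obtain G H where GH: "G \<in> C" "H \<in> C" "p \<in> G" "q \<in> H" by blast
      then have "G \<subseteq> H \<or> H \<subseteq> G" using C by (auto simp: subset_chain_def)
      then obtain J where "J \<in> C" "p \<in> J" "q \<in> J" using GH by blast
      then show "disjnt (B p) (B q)"
        using C\<Omega> \<open>p \<noteq> q\<close> by (auto simp: \<Omega>_def pairwise_def)
    qed
    moreover have "\<Union>C \<subseteq> F" using C\<Omega> by (auto simp: \<Omega>_def)
    moreover have "\<exists>q\<in>\<Union>C. \<not> disjnt (B p) (B q) \<and> snd p \<le> 2 * snd q"
      if p: "p \<in> F" and q: "q \<in> \<Union>C" "\<not> disjnt (B p) (B q)" for p q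
    proof -
      obtain G where G: "G \<in> C" "q \<in> G" using q by blast
      then have "G \<in> \<Omega>" using C\<Omega> by blast
      then have "\<exists>q\<in>G. \<not> disjnt (B p) (B q) \<and> snd p \<le> 2 * snd q"
        using p q(2) G(2) unfolding \<Omega>_def by blast
      then show ?thesis using G(1) by blast
    qed
    ultimately show "\<Union>C \<in> \<Omega>" unfolding \<Omega>_def by blast
  qed
  then obtain G where G: "G \<in> \<Omega>" and max: "\<And>H. H \<in> \<Omega> \<Longrightarrow> G \<subseteq> H \<Longrightarrow> H = G" by blast
  \<comment> \<open>The balls that miss all of \<open>G\<close>. If there were any, one with radius
    above half the supremum of their radii could be added: a ball of \<open>F'\<close> meeting the
    enlarged family meets this one, and any other ball of \<open>F\<close> meets \<open>G\<close>
    already. This contradicts maximality.\<close>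
  define F' where "F' = {p \<in> F. \<forall>q\<in>G. disjnt (B p) (B q)}"
  have "F' = {}"
  proof (rule ccontr)
    assume ne: "F' \<noteq> {}"
    have bdd: "bdd_above (snd ` F')"
      using F by (intro bdd_aboveI[of _ R]) (auto simp: F'_def)
    obtain p1 where "p1 \<in> F'" using ne by blast
    then have "0 < snd p1" "snd p1 \<le> Sup (snd ` F')"
      using F bdd by (auto simp: F'_def intro!: cSup_upper)
    then have "Sup (snd ` F') / 2 < Sup (snd ` F')" by linarith
    then have "\<exists>y\<in>snd ` F'. Sup (snd ` F') / 2 < y"
      using less_cSup_iff[of "snd ` F'" "Sup (snd ` F') / 2"] ne bdd by blast
    then obtain p0 where p0: "p0 \<in> F'" "Sup (snd ` F') / 2 < snd p0"
      by blast
    have "insert p0 G \<in> \<Omega>"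
    proof -
      have "insert p0 G \<subseteq> F" using G p0 by (auto simp: \<Omega>_def F'_def)
      moreover have "pairwise (\<lambda>p q. disjnt (B p) (B q)) (insert p0 G)"
        using G p0 by (auto simp: \<Omega>_def F'_def pairwise_insert disjnt_sym)
      moreover have "\<exists>q\<in>insert p0 G. \<not> disjnt (B p) (B q) \<and> snd p \<le> 2 * snd q"
        if p: "p \<in> F" and q: "q \<in> insert p0 G" "\<not> disjnt (B p) (B q)" for p q
      proof (cases "p \<in> F'")
        case True
        then have "q = p0" using q by (auto simp: F'_def)
        moreover have "snd p \<le> Sup (snd ` F')" using True bdd by (intro cSup_upper) auto
        ultimately show ?thesis using q p0 by auto
      next
        case False
        then obtain q' where "q' \<in> G" "\<not> disjnt (B p) (B q')" using p by (auto simp: F'_def)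
        then have "\<exists>q\<in>G. \<not> disjnt (B p) (B q) \<and> snd p \<le> 2 * snd q"
          using p G unfolding \<Omega>_def by blast
        then show ?thesis by blast
      qed
      ultimately show ?thesis unfolding \<Omega>_def by blast
    qed
    then have "p0 \<in> G" using max by blast
    then have "disjnt (B p0) (B p0)" using p0(1) unfolding F'_def by blast
    moreover have "fst p0 \<in> B p0" using F[of p0] p0(1) by (simp add: B_def F'_def mdist_self)
    ultimately show False by (auto simp: disjnt_def)
  qed
  \<comment> \<open>The factor 5: with \<open>s = snd q\<close>, a common point \<open>u\<close> is
    within \<open>s\<close> of the centre of \<open>q\<close>, and the ball of \<open>p\<close>,
    having radius at most \<open>2*s\<close>, lies within \<open>4*s\<close> of
    \<open>u\<close>.\<close>
  have "\<exists>q\<in>G. B p \<subseteq> mball_of X (fst q) (5 * snd q)" if p: "p \<in> F" for p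
  proof -
    obtain q' where "q' \<in> G" "\<not> disjnt (B p) (B q')"
      using p \<open>F' = {}\<close> unfolding F'_def by blast
    then obtain q where q: "q \<in> G" "\<not> disjnt (B p) (B q)" "snd p \<le> 2 * snd q"
      using p G unfolding \<Omega>_def by blast
    then obtain u where u: "u \<in> B p" "u \<in> B q" by (auto simp: disjnt_def)
    have "x \<in> mball_of X (fst q) (5 * snd q)" if x: "x \<in> B p" for x
    proof -
      have m: "fst q \<in> mspace X" "u \<in> mspace X" "fst p \<in> mspace X" "x \<in> mspace X"
        using u x by (auto simp: B_def)
      have "mdist X (fst q) u < snd q" "mdist X (fst p) u < snd p" "mdist X (fst p) x < snd p"
        using u x by (auto simp: B_def)
      then show ?thesis
        using m q(3) mdist_triangle[of "fst q" X u x] mdist_triangle[of u X "fst p" x]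
        by (simp add: mdist_commute)
    qed
    then show ?thesis using q(1) by blast
  qed
  then show thesis
    using that[of G] G unfolding \<Omega>_def B_def by blast
qed

section \<open>Measure estimates from families of balls\<close>

lemma hausdorff_measure_disjoint_UN:
  assumes "finite I" "disjoint_family_on B I" "\<And>i. i \<in> I \<Longrightarrow> openin (mtopology_of X) (B i)"
  shows "(\<Sum>i\<in>I. hausdorff_measure X n (B i)) = hausdorff_measure X n (\<Union>i\<in>I. B i)"
proof -
  have s: "B i \<in> sets (hausdorff_space X n)" if "i \<in> I" for i
    using assms(3)[OF that] by (simp add: openin_hausdorff_sets)
  then have "(\<Sum>i\<in>I. emeasure (hausdorff_space X n) (B i)) = emeasure (hausdorff_space X n) (\<Union>i\<in>I. B i)"
    using assms by (intro sum_emeasure) auto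
  moreover have "(\<Union>i\<in>I. B i) \<in> hausdorff_sets X n"
    using s sets.finite_UN[OF assms(1), of B "hausdorff_space X n"] by simp
  ultimately show ?thesis using s by simp
qed

text \<open>The diameter is at most twice the radius, and the resulting \<open>2^n\<close> cancels
  against the normalizing factor.\<close>

lemma hausdorff_weight_mball_le:
  assumes "0 \<le> \<rho>"
  shows "hausdorff_weight X n (mball_of X z \<rho>) \<le> ennreal (unit_ball_vol (real n) * \<rho> ^ n)"
proof (cases "mball_of X z \<rho> = {}")
  case False
  have "ediam X (mball_of X z \<rho>) \<le> ennreal (2 * \<rho>)"
  proof (rule ediam_le, rule ennreal_leI)
    fix x y assume "x \<in> mball_of X z \<rho>" "y \<in> mball_of X z \<rho>"
    then show "mdist X x y \<le> 2 * \<rho>"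
      using mdist_triangle[of x X z y] by (simp add: mdist_commute)
  qed
  then have "hausdorff_weight X n (mball_of X z \<rho>) \<le> ennreal (unit_ball_vol (real n) / 2 ^ n) * ennreal (2 * \<rho>) ^ n"
    unfolding hausdorff_weight_def using False by (auto intro!: mult_left_mono power_mono)
  also have "\<dots> = ennreal (unit_ball_vol (real n) * \<rho> ^ n)"
    using assms by (simp add: ennreal_power ennreal_mult[symmetric] power_mult_distrib)
  finally show ?thesis .
qed simp

text \<open>Vitali's lemma selects disjoint dense balls whose fivefold enlargements cover
  \<open>A\<close>. Enlarging costs \<open>5^n\<close> in the weight, density turns each
  \<open>\<rho>^n\<close> into measure divided by \<open>K\<close>, and disjointness bounds the
  total by the measure of \<open>W\<close>.\<close>

lemma hausdorff_measure_le_of_dense_balls: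
  assumes W: "hausdorff_measure X n W < \<infinity>" and K: "K > 0"
    and dense: "\<And>x \<delta>. x \<in> A \<Longrightarrow> \<delta> > 0 \<Longrightarrow> \<exists>z\<in>mspace X. \<exists>\<rho>>0. \<rho> < \<delta> \<and> x \<in> mball_of X z \<rho> \<and>
      mball_of X z \<rho> \<subseteq> W \<and> ennreal (K * \<rho> ^ n) \<le> hausdorff_measure X n (mball_of X z \<rho>)"
  shows "hausdorff_measure X n A \<le> ennreal (unit_ball_vol (real n) * 5 ^ n / K) * hausdorff_measure X n W"
proof (rule hausdorff_measure_least)
  fix \<delta> :: real assume "\<delta> > 0"
  let ?H = "hausdorff_measure X n"
  define B where "B p = mball_of X (fst p) (snd p)" for p
  define B5 where "B5 p = mball_of X (fst p) (5 * snd p)" for p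
  \<comment> \<open>Radii below \<open>\<delta> / 10\<close> keep the diameters of the enlarged
    balls, at most ten times the radius, below \<open>\<delta>\<close>.\<close>
  define F where "F = {p. fst p \<in> mspace X \<and> 0 < snd p \<and> snd p < \<delta> / 10 \<and> B p \<subseteq> W \<and>
    ennreal (K * snd p ^ n) \<le> ?H (B p)}"
  obtain G where G: "G \<subseteq> F" "pairwise (\<lambda>p q. disjnt (B p) (B q)) G"
    "\<And>p. p \<in> F \<Longrightarrow> \<exists>q\<in>G. B p \<subseteq> B5 q"
    by (rule Vitali_covering_5r[of F X "\<delta> / 10"]) (auto simp: F_def B_def B5_def)
  have fin: "(\<Sum>p\<in>G'. ?H (B p)) \<le> ?H W" if "finite G'" "G' \<subseteq> G" for G'
  proof -
    have "(\<Sum>p\<in>G'. ?H (B p)) = ?H (\<Union>p\<in>G'. B p)"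
    proof (rule hausdorff_measure_disjoint_UN)
      show "disjoint_family_on B G'"
        unfolding disjoint_family_on_def using that G(2) unfolding pairwise_def disjnt_def by blast
    qed (use that in \<open>auto simp: B_def openin_mball_of\<close>)
    also have "\<dots> \<le> ?H W"
      using that G(1) by (intro hausdorff_measure_mono) (auto simp: F_def)
    finally show ?thesis .
  qed
  \<comment> \<open>Countability of \<open>G\<close>: the finite subsums are bounded by the finite
    measure of \<open>W\<close>, and a summable family has only countably many nonzero
    terms.\<close>
  have "(\<lambda>p. K * snd p ^ n) summable_on G"
  proof (rule nonneg_bdd_above_summable_on)
    show "0 \<le> K * snd p ^ n" if "p \<in> G" for p using that G(1) K by (auto simp: F_def)
    show "bdd_above (sum (\<lambda>p. K * snd p ^ n) ` {G'. G' \<subseteq> G \<and> finite G'})"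
    proof (rule bdd_aboveI)
      fix s assume "s \<in> sum (\<lambda>p. K * snd p ^ n) ` {G'. G' \<subseteq> G \<and> finite G'}"
      then obtain G' where G': "G' \<subseteq> G" "finite G'" "s = (\<Sum>p\<in>G'. K * snd p ^ n)" by blast
      have "ennreal s = (\<Sum>p\<in>G'. ennreal (K * snd p ^ n))"
        unfolding G'(3) using G'(1) G(1) K by (intro sum_ennreal[symmetric]) (auto simp: F_def)
      also have "\<dots> \<le> (\<Sum>p\<in>G'. ?H (B p))"
        using G'(1) G(1) by (intro sum_mono) (auto simp: F_def)
      also have "\<dots> \<le> ?H W" by (rule fin) fact+
      finally show "s \<le> enn2real (?H W)"
        using W by (metis enn2real_leI enn2real_nonneg ennreal_enn2real ennreal_le_iff infinity_ennreal_def)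
    qed
  qed
  then have "countable {p \<in> G. K * snd p ^ n \<noteq> 0}" by (rule summable_countable_real)
  moreover have "{p \<in> G. K * snd p ^ n \<noteq> 0} = G" using K G(1) by (auto simp: F_def)
  ultimately have cG: "countable G" by simp
  define I where "I = to_nat_on G ` G"
  define g where "g = from_nat_into G"
  have g: "g (to_nat_on G p) = p" if "p \<in> G" for p
    using that cG by (simp add: g_def)
  have gI: "g ` I \<subseteq> G" "inj_on g I" unfolding I_def by (auto simp: g inj_on_def)
  define E where "E i = (if i \<in> I then B5 (g i) else {})" for i
  let ?c = "ennreal (unit_ball_vol (real n) * 5 ^ n / K)"
  have "small_cover X \<delta> A E"
    unfolding small_cover_def
  proof (intro conjI allI)
    fix i
    show "E i \<subseteq> mspace X" by (auto simp: E_def B5_def)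
    show "ediam X (E i) < ennreal \<delta>"
    proof (cases "i \<in> I")
      case True
      then have "g i \<in> F" using gI G(1) by blast
      then have s: "0 < snd (g i)" "snd (g i) < \<delta> / 10" by (auto simp: F_def)
      have "ediam X (E i) \<le> ennreal (10 * snd (g i))"
      proof (rule ediam_le, rule ennreal_leI)
        fix x y assume "x \<in> E i" "y \<in> E i"
        then show "mdist X x y \<le> 10 * snd (g i)"
          using True mdist_triangle[of x X "fst (g i)" y] by (simp add: mdist_commute E_def B5_def)
      qed
      also have "\<dots> < ennreal \<delta>" using s by (intro ennreal_lessI) auto
      finally show ?thesis .
    qed (use \<open>\<delta> > 0\<close> in \<open>simp add: E_def\<close>)
  next
    show "A \<subseteq> (\<Union>i. E i)"
    proof
      fix x assume "x \<in> A"
      then obtain p where "p \<in> F" "x \<in> B p"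
        using dense[of x "\<delta> / 10"] \<open>\<delta> > 0\<close> unfolding F_def B_def by force
      then obtain q where "q \<in> G" "x \<in> B5 q" using G(3) by blast
      then have "x \<in> E (to_nat_on G q)" by (simp add: E_def I_def g)
      then show "x \<in> (\<Union>i. E i)" by (rule UN_I[OF UNIV_I])
    qed
  qed
  then have "hausdorff_content X n \<delta> A \<le> (\<Sum>i. hausdorff_weight X n (E i))"
    by (rule hausdorff_content_le)
  also have "\<dots> \<le> ?c * ?H W"
  proof (rule suminf_le_const)
    fix m
    have "(\<Sum>i<m. hausdorff_weight X n (E i)) = (\<Sum>i\<in>{..<m} \<inter> I. hausdorff_weight X n (B5 (g i)))"
      by (rule sum.mono_neutral_cong_right) (auto simp: E_def)
    also have "\<dots> \<le> (\<Sum>i\<in>{..<m} \<inter> I. ?c * ?H (B (g i)))"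
    proof (rule sum_mono)
      fix i assume "i \<in> {..<m} \<inter> I"
      then have gi: "g i \<in> F" using gI G(1) by blast
      then have s: "0 < snd (g i)" by (simp add: F_def)
      have "hausdorff_weight X n (B5 (g i)) \<le> ennreal (unit_ball_vol (real n) * (5 * snd (g i)) ^ n)"
        unfolding B5_def using s by (intro hausdorff_weight_mball_le) auto
      also have "\<dots> = ?c * ennreal (K * snd (g i) ^ n)"
        using K s by (subst ennreal_mult[symmetric]) (auto simp: power_mult_distrib)
      also have "\<dots> \<le> ?c * ?H (B (g i))"
        using gi by (intro mult_left_mono) (auto simp: F_def)
      finally show "hausdorff_weight X n (B5 (g i)) \<le> ?c * ?H (B (g i))" .
    qed
    also have "\<dots> = ?c * (\<Sum>p\<in>g ` ({..<m} \<inter> I). ?H (B p))"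
      using gI(2) by (subst sum.reindex) (auto simp: sum_distrib_left inj_on_def)
    also have "\<dots> \<le> ?c * ?H W"
      using gI by (intro mult_left_mono fin) auto
    finally show "(\<Sum>i<m. hausdorff_weight X n (E i)) \<le> ?c * ?H W" .
  qed auto
  finally show "hausdorff_content X n \<delta> A \<le> ?c * ?H W" .
qed

section \<open>Points of high density\<close>

text \<open>Taking whole balls, not only their centres, makes this set open, and the intersection
  over \<open>k\<close> is then the G-delta set of points lying in arbitrarily small balls of
  density above \<open>K\<close>.\<close>

definition thick_set :: "'a metric \<Rightarrow> nat \<Rightarrow> real \<Rightarrow> nat \<Rightarrow> 'a set" where
  "thick_set X n K k = (\<Union>(z, \<rho>) \<in> {(z, \<rho>). z \<in> mspace X \<and> 0 < \<rho> \<and> \<rho> < 1 / real (Suc k) \<and>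
     ennreal (K * \<rho> ^ n) < hausdorff_measure X n (mball_of X z \<rho>)}. mball_of X z \<rho>)"

lemma openin_thick_set: "openin (mtopology_of X) (thick_set X n K k)"
  unfolding thick_set_def by (intro openin_clauses) (auto simp: openin_mball_of)

lemma thick_set_iff:
  "x \<in> thick_set X n K k \<longleftrightarrow> (\<exists>z\<in>mspace X. \<exists>\<rho>>0. \<rho> < 1 / real (Suc k) \<and>
     ennreal (K * \<rho> ^ n) < hausdorff_measure X n (mball_of X z \<rho>) \<and> x \<in> mball_of X z \<rho>)"
  unfolding thick_set_def by blast

lemma thick_set_antimono: "j \<le> k \<Longrightarrow> thick_set X n K k \<subseteq> thick_set X n K j"
proof -
  assume "j \<le> k"
  then have "1 / real (Suc k) \<le> 1 / real (Suc j)" by (simp add: field_simps)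
  then show ?thesis unfolding subset_iff thick_set_iff by (meson less_le_trans)
qed

text \<open>This \<open>K\<close> turns the constant
  \<open>unit_ball_vol (real n) * 5 ^ n / K\<close> of the covering estimate into 1/2, so the
  intersection has at most half the measure of each \<open>W k\<close>.\<close>

lemma thick_set_null_finite:
  assumes V: "openin (mtopology_of X) V" "hausdorff_measure X n V < \<infinity>"
  shows "hausdorff_measure X n (\<Inter>k. thick_set X n (2 * 5 ^ n * unit_ball_vol (real n)) k \<inter> V) = 0"
proof -
  define K where "K = 2 * 5 ^ n * unit_ball_vol (real n)"
  have K: "K > 0" by (simp add: K_def)
  let ?H = "hausdorff_measure X n"
  define W where "W k = thick_set X n K k \<inter> V" for k
  have W_open: "openin (mtopology_of X) (W k)" for k
    unfolding W_def by (intro openin_Int openin_thick_set V)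
  have W_fin: "?H (W k) < \<infinity>" for k
    using hausdorff_measure_mono[of "W k" V X n] V(2) by (auto simp: W_def intro: le_less_trans)
  have half: "?H (\<Inter>k. W k) \<le> ennreal (1/2) * ?H (W k)" for k
  proof -
    have "unit_ball_vol (real n) \<noteq> 0"
      using unit_ball_vol_pos[of "real n"] by linarith
    then have eq: "unit_ball_vol (real n) * 5 ^ n / K = 1 / 2" by (simp add: K_def)
    have "?H (\<Inter>k. W k) \<le> ennreal (unit_ball_vol (real n) * 5 ^ n / K) * ?H (W k)"
    proof (rule hausdorff_measure_le_of_dense_balls[OF W_fin K])
      fix x :: 'a and \<delta> :: real assume x: "x \<in> (\<Inter>k. W k)" and "\<delta> > 0"
      then have "x \<in> V" by (auto simp: W_def)
      then obtain r where r: "r > 0" "mball_of X x r \<subseteq> V"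
        using V(1) by (auto simp: openin_mtopology_of)
      \<comment> \<open>A ball of radius \<open>\<rho>\<close> containing \<open>x\<close> lies
        within \<open>2 * \<rho>\<close> of \<open>x\<close>; radii below \<open>r / 2\<close>
        therefore keep it inside \<open>V\<close>. Taking \<open>j \<ge> k\<close> also keeps it
        inside the \<open>k\<close>-th thick set.\<close>
      obtain m where m: "1 / real (Suc m) < min \<delta> (r / 2)"
        using reals_Archimedean[of "min \<delta> (r/2)"] r \<open>\<delta> > 0\<close> by (auto simp: inverse_eq_divide)
      define j where "j = max k m"
      have j: "1 / real (Suc j) \<le> 1 / real (Suc m)" "1 / real (Suc j) \<le> 1 / real (Suc k)"
        unfolding j_def by (auto simp: field_simps)
      have "x \<in> thick_set X n K j" using x by (auto simp: W_def)
      then obtain z \<rho> where z: "z \<in> mspace X" "0 < \<rho>" "\<rho> < 1 / real (Suc j)"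
        "ennreal (K * \<rho> ^ n) < ?H (mball_of X z \<rho>)" "x \<in> mball_of X z \<rho>"
        unfolding thick_set_iff by blast
      have "mball_of X z \<rho> \<subseteq> thick_set X n K k"
      proof -
        have "\<rho> < 1 / real (Suc k)" using z(3) j(2) by linarith
        then show ?thesis unfolding subset_iff thick_set_iff using z by blast
      qed
      moreover have "mball_of X z \<rho> \<subseteq> V"
      proof
        fix y assume y: "y \<in> mball_of X z \<rho>"
        have "2 * \<rho> < r" using z(3) j(1) m by linarith
        then have "y \<in> mball_of X x r"
          using y z(5) mdist_triangle[of x X z y] by (simp add: mdist_commute)
        then show "y \<in> V" using r by blast
      qed
      moreover have "\<rho> < \<delta>" using z(3) j(1) m by linarith
      ultimately show "\<exists>z\<in>mspace X. \<exists>\<rho>>0. \<rho> < \<delta> \<and> x \<in> mball_of X z \<rho> \<and> mball_of X z \<rho> \<subseteq> W k \<and>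
          ennreal (K * \<rho> ^ n) \<le> ?H (mball_of X z \<rho>)"
        using z unfolding W_def by (meson Int_greatest less_imp_le)
    qed
    then show ?thesis unfolding eq .
  qed
  have W_sets: "W k \<in> hausdorff_sets X n" for k by (rule openin_hausdorff_sets[OF W_open])
  \<comment> \<open>Continuity from above, valid because the \<open>W k\<close> have finite measure.
    In the limit \<open>half\<close> bounds a finite number by its own half, so that number is
    zero.\<close>
  have "(\<lambda>k. emeasure (hausdorff_space X n) (W k)) \<longlonglongrightarrow> emeasure (hausdorff_space X n) (\<Inter>k. W k)"
  proof (rule Lim_emeasure_decseq)
    show "range W \<subseteq> sets (hausdorff_space X n)" using W_sets by auto
    show "decseq W" using thick_set_antimono by (fastforce simp: decseq_def W_def)
    show "emeasure (hausdorff_space X n) (W i) \<noteq> \<infinity>" for i using W_fin[of i] W_sets[of i] by simp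
  qed
  moreover have "(\<Inter>k. W k) \<in> sets (hausdorff_space X n)"
    using W_sets by (intro sets.countable_INT) auto
  ultimately have "(\<lambda>k. ?H (W k)) \<longlonglongrightarrow> ?H (\<Inter>k. W k)"
    using W_sets by simp
  then have "(\<lambda>k. ennreal (1/2) * ?H (W k)) \<longlonglongrightarrow> ennreal (1/2) * ?H (\<Inter>k. W k)"
    by (rule ennreal_tendsto_cmult[OF ennreal_less_top])
  then have le: "?H (\<Inter>k. W k) \<le> ennreal (1/2) * ?H (\<Inter>k. W k)"
    using half by (intro LIMSEQ_le_const) auto
  have "?H (\<Inter>k. W k) < \<infinity>"
    using hausdorff_measure_mono[of "\<Inter>k. W k" "W 0" X n] W_fin[of 0] by (auto intro: le_less_trans)
  then obtain h where h: "?H (\<Inter>k. W k) = ennreal h" "h \<ge> 0"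
    by (metis ennreal_cases infinity_ennreal_def less_irrefl)
  have "ennreal h \<le> ennreal (1/2 * h)"
    using le h ennreal_mult[of "1/2" h] by simp
  then have "h = 0" using h(2) by simp
  then show ?thesis using h(1) unfolding W_def K_def by simp
qed

lemma thick_set_null:
  assumes "open_sigma_finite_hausdorff X n"
  shows "hausdorff_measure X n (\<Inter>k. thick_set X n (2 * 5 ^ n * unit_ball_vol (real n)) k) = 0"
proof -
  let ?N = "\<Inter>k. thick_set X n (2 * 5 ^ n * unit_ball_vol (real n)) k"
  obtain V :: "nat \<Rightarrow> 'a set" where V: "\<And>i. openin (mtopology_of X) (V i)"
    "\<And>i. hausdorff_measure X n (V i) < \<infinity>" "(\<Union>i. V i) = mspace X"
    using assms unfolding open_sigma_finite_hausdorff_def by blast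
  have "?N \<subseteq> mspace X"
    using openin_thick_set[of X n "2 * 5 ^ n * unit_ball_vol (real n)" 0] by (auto simp: openin_mtopology_of)
  then have "?N \<subseteq> (\<Union>i. ?N \<inter> V i)" using V(3) by blast
  then have "hausdorff_measure X n ?N \<le> hausdorff_measure X n (\<Union>i. ?N \<inter> V i)"
    by (rule hausdorff_measure_mono)
  also have "\<dots> \<le> (\<Sum>i. hausdorff_measure X n (?N \<inter> V i))" by (rule hausdorff_measure_UN)
  also have "\<dots> = 0"
    using thick_set_null_finite[OF V(1,2)] by simp
  finally show ?thesis by simp
qed

section \<open>Curve length\<close>

definition polygonal_length :: "'a metric \<Rightarrow> (real \<Rightarrow> 'a) \<Rightarrow> real list \<Rightarrow> ennreal" where
  "polygonal_length X \<gamma> ts = (\<Sum>i<length ts - 1. ennreal (mdist X (\<gamma> (ts ! i)) (\<gamma> (ts ! Suc i))))"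

lemma polygonal_length_Cons_Cons:
  "polygonal_length X \<gamma> (s # t # ts) = ennreal (mdist X (\<gamma> s) (\<gamma> t)) + polygonal_length X \<gamma> (t # ts)"
  by (simp add: polygonal_length_def sum.lessThan_Suc_shift del: sum.lessThan_Suc sum_ennreal)

lemma polygonal_length_trivial [simp]: "polygonal_length X \<gamma> [] = 0" "polygonal_length X \<gamma> [s] = 0"
  by (simp_all add: polygonal_length_def)

text \<open>Only an inequality, because the concatenation also contains the segment joining the last
  node of \<open>ts\<close> to the first node of \<open>ts'\<close>.\<close>

lemma polygonal_length_append:
  "polygonal_length X \<gamma> ts + polygonal_length X \<gamma> ts' \<le> polygonal_length X \<gamma> (ts @ ts')"
proof (induction ts)
  case (Cons s ts)
  show ?case
  proof (cases ts)
    case Nil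
    then show ?thesis
      by (cases ts') (simp_all add: polygonal_length_Cons_Cons)
  next
    case (Cons t us)
    then show ?thesis
      using Cons.IH by (simp add: polygonal_length_Cons_Cons add.assoc add_left_mono)
  qed
qed simp

lemma curve_length_alt:
  "curve_length X I \<gamma> = (SUP ts \<in> {ts. sorted ts \<and> set ts \<subseteq> I}. polygonal_length X \<gamma> ts)"
  unfolding curve_length_def polygonal_length_def ..

lemma polygonal_length_le_curve_length:
  "sorted ts \<Longrightarrow> set ts \<subseteq> I \<Longrightarrow> polygonal_length X \<gamma> ts \<le> curve_length X I \<gamma>"
  unfolding curve_length_alt by (rule SUP_upper) simp

lemma curve_length_mono: "J \<subseteq> I \<Longrightarrow> curve_length X J \<gamma> \<le> curve_length X I \<gamma>"
  unfolding curve_length_alt by (rule SUP_subset_mono) auto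

lemma mdist_le_curve_length:
  assumes "s \<in> I" "t \<in> I"
  shows "ennreal (mdist X (\<gamma> s) (\<gamma> t)) \<le> curve_length X I \<gamma>"
proof -
  have "ennreal (mdist X (\<gamma> u) (\<gamma> v)) \<le> curve_length X I \<gamma>" if "u \<le> v" "u \<in> I" "v \<in> I" for u v
    using polygonal_length_le_curve_length[of "[u, v]" I X \<gamma>] that by (simp add: polygonal_length_def)
  then show ?thesis using assms by (metis linear mdist_commute)
qed

lemma curve_length_superadditive:
  assumes "u \<le> v" "v \<le> w"
  shows "curve_length X {u..v} \<gamma> + curve_length X {v..w} \<gamma> \<le> curve_length X {u..w} \<gamma>"
proof -
  \<comment> \<open>A summand can be moved inside a supremum in \<open>ennreal\<close> only over a
    nonempty index set; the empty list serves as the member.\<close>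
  have ne: "{ts. sorted ts \<and> set ts \<subseteq> I} \<noteq> {}" for I :: "real set"
    using sorted0 by (metis (mono_tags) empty_Collect_eq empty_subsetI list.set(1))
  have "curve_length X {u..v} \<gamma> + curve_length X {v..w} \<gamma>
      = (SUP ts\<in>{ts. sorted ts \<and> set ts \<subseteq> {u..v}}. SUP ts'\<in>{ts. sorted ts \<and> set ts \<subseteq> {v..w}}.
          polygonal_length X \<gamma> ts + polygonal_length X \<gamma> ts')"
    unfolding curve_length_alt ennreal_SUP_add_left[OF ne, symmetric] ennreal_SUP_add_right[OF ne]
    by (rule SUP_commute)
  also have "\<dots> \<le> curve_length X {u..w} \<gamma>"
  proof (intro SUP_least)
    fix ts ts' assume "ts \<in> {ts. sorted ts \<and> set ts \<subseteq> {u..v}}" "ts' \<in> {ts. sorted ts \<and> set ts \<subseteq> {v..w}}"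
    then have "sorted (ts @ ts')" "set (ts @ ts') \<subseteq> {u..w}"
      using assms by (fastforce simp: sorted_append)+
    then show "polygonal_length X \<gamma> ts + polygonal_length X \<gamma> ts' \<le> curve_length X {u..w} \<gamma>"
      using polygonal_length_append polygonal_length_le_curve_length order_trans by blast
  qed
  finally show ?thesis .
qed

section \<open>Increments bounded by superadditive interval functions\<close>

text \<open>Stated for an abstract \<open>\<Lambda>\<close> and an arbitrary increasing sequence,
  since it serves both the uniform partitions below and the partitions that define the length of a
  curve.\<close>

lemma superadditive_sum_le:
  fixes \<Lambda> :: "real \<Rightarrow> real \<Rightarrow> ennreal"
  assumes add: "\<And>u v w. u \<le> v \<Longrightarrow> v \<le> w \<Longrightarrow> \<Lambda> u v + \<Lambda> v w \<le> \<Lambda> u w"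
    and t: "\<And>i. i < m \<Longrightarrow> t i \<le> t (Suc i)"
  shows "(\<Sum>i<m. \<Lambda> (t i) (t (Suc i))) \<le> \<Lambda> (t 0) (t m)"
proof -
  have "t 0 \<le> t m \<and> (\<Sum>i<m. \<Lambda> (t i) (t (Suc i))) \<le> \<Lambda> (t 0) (t m)" using t
  proof (induction m)
    case (Suc m)
    then have IH: "t 0 \<le> t m" "(\<Sum>i<m. \<Lambda> (t i) (t (Suc i))) \<le> \<Lambda> (t 0) (t m)" by auto
    have "t m \<le> t (Suc m)" using Suc.prems by simp
    moreover have "(\<Sum>i<Suc m. \<Lambda> (t i) (t (Suc i))) \<le> \<Lambda> (t 0) (t m) + \<Lambda> (t m) (t (Suc m))"
      using IH(2) by (simp add: add_right_mono)
    ultimately show ?case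
      using IH(1) add[of "t 0" "t m" "t (Suc m)"] by (meson order_trans)
  qed simp
  then show ?thesis ..
qed

text \<open>
  Points where the estimate holds at all scales below \<open>1/k\<close> lie, for every finer uniform
  partition, in pieces on which it holds; so their image has measure at most \<open>\<Lambda> a b\<close>.
\<close>

lemma increment_le_superadditive:
  fixes g :: "real \<Rightarrow> real" and \<Lambda> :: "real \<Rightarrow> real \<Rightarrow> ennreal"
  assumes ab: "a \<le> b" and g: "continuous_on {a..b} g"
    and add: "\<And>u v w. u \<le> v \<Longrightarrow> v \<le> w \<Longrightarrow> \<Lambda> u v + \<Lambda> v w \<le> \<Lambda> u w"
    and loc: "\<And>t. t \<in> S \<Longrightarrow> \<exists>\<delta>>0. \<forall>u v. a \<le> u \<and> u \<le> t \<and> t \<le> v \<and> v \<le> b \<and> v - u < \<delta> \<longrightarrow>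
                (\<forall>p\<in>{u..v}. \<forall>q\<in>{u..v}. ennreal \<bar>g p - g q\<bar> \<le> \<Lambda> u v)"
    and S: "S \<subseteq> {a..b}" and null: "negligible (g ` ({a..b} - S))"
  shows "ennreal \<bar>g b - g a\<bar> \<le> \<Lambda> a b"
proof -
  \<comment> \<open>The nodes of the uniform partition into \<open>m + 1\<close> pieces; the shift
    by one avoids division by zero.\<close>
  define t where "t m i = a + (b - a) * (real i / real (Suc m))" for m i
  define J where "J m i = {t m i..t m (Suc i)}" for m i
  define good where "good m i \<longleftrightarrow> (\<forall>p\<in>J m i. \<forall>q\<in>J m i. ennreal \<bar>g p - g q\<bar> \<le> \<Lambda> (t m i) (t m (Suc i)))" for m i
  define T where "T m = (\<Union>i\<in>{i. i < Suc m \<and> good m i}. g ` J m i)" for m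
  have t_le: "t m i \<le> t m (Suc i)" for m i
    unfolding t_def using ab by (intro add_left_mono mult_left_mono divide_right_mono) auto
  have t_ends: "t m 0 = a" "t m (Suc m) = b" for m unfolding t_def by simp_all
  have t_range: "a \<le> t m i \<and> t m i \<le> b" if "i \<le> Suc m" for m i
  proof -
    have "(b - a) * (real i / real (Suc m)) \<le> (b - a) * 1"
      using that ab by (intro mult_left_mono) (auto simp: field_simps)
    then show ?thesis using ab unfolding t_def by simp
  qed
  have J_sub: "J m i \<subseteq> {a..b}" if "i < Suc m" for m i
    using t_range[of i m] t_range[of "Suc i" m] that unfolding J_def by auto
  have J_compact: "compact (g ` J m i)" if "i < Suc m" for m i
    using J_sub[OF that] continuous_on_subset[OF g] by (intro compact_continuous_image) (auto simp: J_def)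
  have J_sets: "g ` J m i \<in> sets lebesgue" if "i < Suc m" for m i
    using lmeasurable_compact[OF J_compact[OF that]] by (rule fmeasurableD)
  have T_sets: "T m \<in> sets lebesgue" for m
    unfolding T_def using J_sets by (intro sets.finite_UN) auto
  \<comment> \<open>On a good piece \<open>g\<close> attains its minimum and maximum, so the image
    lies in an interval whose length is one of the differences that \<open>good\<close>
    controls.\<close>
  have J_le: "emeasure lebesgue (g ` J m i) \<le> \<Lambda> (t m i) (t m (Suc i))" if i: "i < Suc m" "good m i" for m i
  proof -
    have J: "compact (J m i)" "J m i \<noteq> {}" "continuous_on (J m i) g"
      using t_le[of m i] J_sub[OF i(1)] continuous_on_subset[OF g] by (auto simp: J_def)
    obtain p where p: "p \<in> J m i" "\<And>x. x \<in> J m i \<Longrightarrow> g p \<le> g x"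
      using continuous_attains_inf[OF J] by blast
    obtain q where q: "q \<in> J m i" "\<And>x. x \<in> J m i \<Longrightarrow> g x \<le> g q"
      using continuous_attains_sup[OF J] by blast
    have "emeasure lebesgue (g ` J m i) \<le> emeasure lebesgue {g p..g q}"
      using p q by (intro emeasure_mono) auto
    also have "\<dots> = ennreal \<bar>g p - g q\<bar>" using p(2)[OF q(1)] by simp
    also have "\<dots> \<le> \<Lambda> (t m i) (t m (Suc i))" using i(2) p(1) q(1) unfolding good_def by blast
    finally show ?thesis .
  qed
  have T_le: "emeasure lebesgue (T m) \<le> \<Lambda> a b" for m
  proof -
    have "emeasure lebesgue (T m) \<le> (\<Sum>i\<in>{i. i < Suc m \<and> good m i}. emeasure lebesgue (g ` J m i))"
      unfolding T_def using J_sets by (intro emeasure_subadditive_finite) auto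
    also have "\<dots> \<le> (\<Sum>i\<in>{i. i < Suc m \<and> good m i}. \<Lambda> (t m i) (t m (Suc i)))"
      using J_le by (intro sum_mono) auto
    also have "\<dots> \<le> (\<Sum>i<Suc m. \<Lambda> (t m i) (t m (Suc i)))"
      by (intro sum_mono2) auto
    also have "\<dots> \<le> \<Lambda> (t m 0) (t m (Suc m))"
      by (rule superadditive_sum_le[where \<Lambda> = \<Lambda> and t = "t m" and m = "Suc m"]) (rule add t_le; assumption)+
    finally show ?thesis unfolding t_ends .
  qed
  \<comment> \<open>The values that lie in the good part of every partition from index
    \<open>k\<close> on. These sets increase with \<open>k\<close>, so the bound on each passes to
    their union.\<close>
  define Q where "Q k = (\<Inter>m. T (m + k))" for k
  have Q_sets: "Q k \<in> sets lebesgue" for k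
    unfolding Q_def using T_sets by (intro sets.countable_INT) auto
  have Q_le: "emeasure lebesgue (Q k) \<le> \<Lambda> a b" for k
  proof -
    have "Q k \<subseteq> T (0 + k)" unfolding Q_def by blast
    then have "emeasure lebesgue (Q k) \<le> emeasure lebesgue (T (0 + k))"
      by (rule emeasure_mono[OF _ T_sets])
    then show ?thesis using T_le by (rule order_trans)
  qed
  have "incseq Q"
  proof (rule incseq_SucI)
    fix k
    show "Q k \<subseteq> Q (Suc k)"
    proof
      fix x assume "x \<in> Q k"
      then have "x \<in> T (Suc m + k)" for m unfolding Q_def by (rule INT_D) simp
      then show "x \<in> Q (Suc k)" unfolding Q_def by simp
    qed
  qed
  then have "emeasure lebesgue (\<Union>k. Q k) = (SUP k. emeasure lebesgue (Q k))"
    using Q_sets by (intro SUP_emeasure_incseq[symmetric]) auto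
  also have "\<dots> \<le> \<Lambda> a b" using Q_le by (intro SUP_least)
  finally have UQ_le: "emeasure lebesgue (\<Union>k. Q k) \<le> \<Lambda> a b" .
  have gS: "g ` S \<subseteq> (\<Union>k. Q k)"
  proof (rule image_subsetI)
    fix s assume s: "s \<in> S"
    then have sab: "a \<le> s" "s \<le> b" using S by auto
    obtain \<delta> where \<delta>: "\<delta> > 0" "\<And>u v. a \<le> u \<Longrightarrow> u \<le> s \<Longrightarrow> s \<le> v \<Longrightarrow> v \<le> b \<Longrightarrow> v - u < \<delta> \<Longrightarrow>
        (\<forall>p\<in>{u..v}. \<forall>q\<in>{u..v}. ennreal \<bar>g p - g q\<bar> \<le> \<Lambda> u v)"
      using loc[OF s] by blast
    \<comment> \<open>From this index on the mesh is below \<open>\<delta>\<close>, so every piece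
      containing \<open>s\<close> is good.\<close>
    obtain k :: nat where k: "(b - a) / \<delta> < real k" using reals_Archimedean2 by blast
    have "g s \<in> T (m + k)" for m
    proof -
      define N where "N = m + k"
      have "real k < real (Suc N)" by (simp add: N_def)
      then have "(b - a) / \<delta> < real (Suc N)" using k by linarith
      then have small: "(b - a) / real (Suc N) < \<delta>" using \<delta>(1) by (simp add: field_simps)
      \<comment> \<open>The first piece whose right end reaches \<open>s\<close>; by minimality its
        left end does not exceed \<open>s\<close>.\<close>
      define i where "i = (LEAST i. s \<le> t N (Suc i))"
      have ex: "s \<le> t N (Suc N)" using sab t_ends by simp
      have i: "s \<le> t N (Suc i)" "i \<le> N"
        unfolding i_def using ex by (rule LeastI, intro Least_le)
      have "t N i \<le> s"
      proof (cases i)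
        case 0 then show ?thesis using sab t_ends by simp
      next
        case (Suc j)
        then show ?thesis using not_less_Least[of j "\<lambda>i. s \<le> t N (Suc i)"] unfolding i_def[symmetric] by simp
      qed
      moreover have "t N (Suc i) - t N i = (b - a) / real (Suc N)"
        unfolding t_def of_nat_Suc[of i] by (simp add: add_divide_distrib algebra_simps)
      ultimately have "good N i"
        using \<delta>(2)[of "t N i" "t N (Suc i)"] i small t_range[of i N] t_range[of "Suc i" N]
        unfolding good_def J_def by auto
      moreover have "s \<in> J N i" unfolding J_def using \<open>t N i \<le> s\<close> i by simp
      moreover have "i < Suc N" using i(2) by simp
      ultimately show ?thesis unfolding T_def N_def[symmetric] by blast
    qed
    then have "g s \<in> Q k" unfolding Q_def by blast
    then show "g s \<in> (\<Union>k. Q k)" by blast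
  qed
  define Z where "Z = g ` ({a..b} - S)"
  have Z: "Z \<in> null_sets lebesgue" using null unfolding Z_def negligible_iff_null_sets .
  \<comment> \<open>By the intermediate value theorem the interval between \<open>g a\<close> and
    \<open>g b\<close> lies in the image of \<open>{a..b}\<close>, which the \<open>Q k\<close>
    cover up to a null set. Its length is the increment sought.\<close>
  define lo hi where "lo = min (g a) (g b)" and "hi = max (g a) (g b)"
  have "connected (g ` {a..b})" by (intro connected_continuous_image g) auto
  moreover have "lo \<in> g ` {a..b}" "hi \<in> g ` {a..b}"
    using ab by (auto simp: lo_def hi_def min_def max_def)
  ultimately have "{lo..hi} \<subseteq> g ` {a..b}" by (rule connected_contains_Icc)
  also have "\<dots> \<subseteq> (\<Union>k. Q k) \<union> Z" using gS S unfolding Z_def by blast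
  finally have "{lo..hi} \<subseteq> (\<Union>k. Q k) \<union> Z" .
  moreover have UQ_sets: "(\<Union>k. Q k) \<in> sets lebesgue" using Q_sets by auto
  ultimately have "emeasure lebesgue {lo..hi} \<le> emeasure lebesgue ((\<Union>k. Q k) \<union> Z)"
    using Z by (intro emeasure_mono) auto
  also have "\<dots> = emeasure lebesgue (\<Union>k. Q k)"
    by (rule emeasure_Un_null_set[OF UQ_sets Z])
  also have "\<dots> \<le> \<Lambda> a b" by (rule UQ_le)
  also have "emeasure lebesgue {lo..hi} = ennreal \<bar>g b - g a\<bar>"
    by (simp add: lo_def hi_def min_def max_def)
  finally show ?thesis .
qed

text \<open>For \<open>n = 1\<close> the weight of a nonempty set is its diameter \<open>d\<close>,
  and its image under \<open>\<phi>\<close> lies in an interval of length \<open>2 * d\<close>. A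
  cover of weight \<open>e / 2\<close> thus yields intervals of total length at most
  \<open>e\<close>. The scale 1 only makes the diameters finite.\<close>

lemma negligible_image_hausdorff_null:
  fixes \<phi> :: "'a \<Rightarrow> real"
  assumes Z: "hausdorff_measure X 1 Z = 0"
    and lip: "\<And>x y. x \<in> mspace X \<Longrightarrow> y \<in> mspace X \<Longrightarrow> \<bar>\<phi> x - \<phi> y\<bar> \<le> mdist X x y"
  shows "negligible (\<phi> ` Z)"
  unfolding negligible_outer_le
proof (intro allI impI)
  fix e :: real assume e: "e > 0"
  have "hausdorff_content X 1 1 Z = 0"
    using hausdorff_content_le_measure[of 1 X 1 Z] Z by simp
  then obtain E where E: "small_cover X 1 Z E" "(\<Sum>i. hausdorff_weight X 1 (E i)) \<le> ennreal (e / 2)"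
    using hausdorff_content_approx[of X 1 1 Z "e / 2"] e by auto
  have "\<exists>A. A \<in> sets lebesgue \<and> \<phi> ` E i \<subseteq> A \<and> emeasure lebesgue A \<le> 2 * hausdorff_weight X 1 (E i)" for i
  proof (cases "E i = {}")
    case False
    then obtain x where x: "x \<in> E i" by blast
    have "ediam X (E i) < ennreal 1" using E(1) by (auto simp: small_cover_def)
    then obtain d where d: "d \<ge> 0" "ediam X (E i) = ennreal d"
      by (metis ennreal_cases ennreal_less_top less_asym' top.not_eq_extremum)
    have "\<phi> y \<in> {\<phi> x - d..\<phi> x + d}" if y: "y \<in> E i" for y
    proof -
      have "\<bar>\<phi> x - \<phi> y\<bar> \<le> mdist X x y"
        using E(1) x y by (intro lip) (auto simp: small_cover_def)
      also have "\<dots> \<le> d" using mdist_le_ediam[OF x y, of X] d by simp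
      finally show ?thesis by auto
    qed
    moreover have "emeasure lebesgue {\<phi> x - d..\<phi> x + d} = 2 * hausdorff_weight X 1 (E i)"
    proof -
      have "hausdorff_weight X 1 (E i) = ennreal d"
        using False d by (simp add: hausdorff_weight_def)
      moreover have "2 * ennreal d = ennreal (2 * d)"
        using d by (simp add: ennreal_mult)
      ultimately show ?thesis using d by simp
    qed
    ultimately show ?thesis by (intro exI[of _ "{\<phi> x - d..\<phi> x + d}"]) auto
  qed (auto intro: exI[of _ "{}"])
  then obtain A where A: "\<And>i. A i \<in> sets lebesgue" "\<And>i. \<phi> ` E i \<subseteq> A i"
    "\<And>i. emeasure lebesgue (A i) \<le> 2 * hausdorff_weight X 1 (E i)"
    by metis
  have "emeasure lebesgue (\<Union>i. A i) \<le> (\<Sum>i. emeasure lebesgue (A i))"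
    using A(1) by (intro emeasure_subadditive_countably) auto
  also have "\<dots> \<le> (\<Sum>i. 2 * hausdorff_weight X 1 (E i))"
    using A(3) by (intro suminf_le) auto
  also have "\<dots> \<le> 2 * ennreal (e / 2)"
    using E(2) by (simp add: mult_left_mono)
  also have "\<dots> = ennreal e" using e ennreal_mult[of 2 "e / 2"] by simp
  finally have le: "emeasure lebesgue (\<Union>i. A i) \<le> ennreal e" .
  show "\<exists>T. \<phi> ` Z \<subseteq> T \<and> T \<in> lmeasurable \<and> measure lebesgue T \<le> e"
  proof (intro exI conjI)
    show "\<phi> ` Z \<subseteq> (\<Union>i. A i)"
    proof (rule image_subsetI)
      fix x assume "x \<in> Z"
      then have "x \<in> (\<Union>i. E i)" using E(1) unfolding small_cover_def by blast
      then show "\<phi> x \<in> (\<Union>i. A i)" using A(2) by blast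
    qed
    show "(\<Union>i. A i) \<in> lmeasurable"
      using A(1) le by (intro fmeasurableI) (auto intro: le_less_trans)
    show "measure lebesgue (\<Union>i. A i) \<le> e"
      unfolding measure_def using le e by (intro enn2real_leI) auto
  qed
qed

section \<open>Volume-preserving Lipschitz maps\<close>

lemma curve_in_mspace: "curve_in X I \<gamma> \<Longrightarrow> t \<in> I \<Longrightarrow> \<gamma> t \<in> mspace X"
  unfolding curve_in_def continuous_map_def by auto

lemma curve_in_continuity:
  assumes \<gamma>: "curve_in X I \<gamma>" and t: "t \<in> I" and e: "e > 0"
  obtains \<delta> where "\<delta> > 0" "\<And>s. s \<in> I \<Longrightarrow> \<bar>s - t\<bar> < \<delta> \<Longrightarrow> mdist X (\<gamma> t) (\<gamma> s) < e"
proof -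
  let ?P = "{s \<in> topspace (top_of_set I). \<gamma> s \<in> mball_of X (\<gamma> t) e}"
  have "openin (top_of_set I) ?P"
    using \<gamma> openin_mball_of unfolding curve_in_def by (metis openin_continuous_map_preimage)
  moreover have "t \<in> ?P"
    using t e curve_in_mspace[OF \<gamma> t] by (simp add: mdist_self)
  ultimately obtain \<delta> where \<delta>: "\<delta> > 0" "\<And>s. s \<in> I \<Longrightarrow> dist s t < \<delta> \<Longrightarrow> s \<in> ?P"
    unfolding openin_euclidean_subtopology_iff by blast
  show thesis
    by (rule that[OF \<delta>(1)]) (use \<delta>(2) in \<open>auto simp: dist_real_def\<close>)
qed

lemma mdist_triangle_abs:
  assumes "x \<in> mspace X" "y \<in> mspace X" "z \<in> mspace X"
  shows "\<bar>mdist X x y - mdist X x z\<bar> \<le> mdist X y z"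
  using mdist_triangle[of x X y z] mdist_triangle[of x X z y] assms by (simp add: mdist_commute abs_le_iff)

lemma curve_in_mdist_continuous:
  assumes \<gamma>: "curve_in X I \<gamma>" and x: "x \<in> mspace X"
  shows "continuous_on I (\<lambda>t. mdist X x (\<gamma> t))"
  unfolding continuous_on_iff
proof (intro ballI allI impI)
  fix t e :: real assume "t \<in> I" "e > 0"
  then obtain \<delta> where \<delta>: "\<delta> > 0" "\<And>s. s \<in> I \<Longrightarrow> \<bar>s - t\<bar> < \<delta> \<Longrightarrow> mdist X (\<gamma> t) (\<gamma> s) < e"
    using curve_in_continuity[OF \<gamma>] by blast
  show "\<exists>d>0. \<forall>s\<in>I. dist s t < d \<longrightarrow> dist (mdist X x (\<gamma> s)) (mdist X x (\<gamma> t)) < e"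
  proof (intro exI[of _ \<delta>] conjI ballI impI)
    fix s assume "s \<in> I" "dist s t < \<delta>"
    then have "mdist X (\<gamma> t) (\<gamma> s) < e" using \<delta>(2) by (simp add: dist_real_def)
    then show "dist (mdist X x (\<gamma> s)) (mdist X x (\<gamma> t)) < e"
      using mdist_triangle_abs[OF x, of "\<gamma> t" "\<gamma> s"] curve_in_mspace[OF \<gamma>] \<open>t \<in> I\<close> \<open>s \<in> I\<close>
      by (simp add: dist_real_def abs_minus_commute)
  qed (fact \<delta>(1))
qed

lemma curve_in_subinterval: "curve_in X I \<gamma> \<Longrightarrow> {u..v} \<subseteq> I \<Longrightarrow> curve_in X {u..v} \<gamma>"
  unfolding curve_in_def
  by (metis continuous_map_from_subtopology_mono is_interval_cc)

lemma lipschitz_mapD: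
  assumes "lipschitz_map L X Y f" "x \<in> mspace X"
  shows "f x \<in> mspace Y" "y \<in> mspace X \<Longrightarrow> mdist Y (f x) (f y) \<le> L * mdist X x y"
  using assms by (auto simp: lipschitz_map_def)

text \<open>
  A long subcurve carries more disjoint balls of radius \<open>r\<close> than there is volume in the ball
  around \<open>y\<close> containing their images.
\<close>

lemma mdist_le_of_image_in_ball:
  fixes M :: nat
  assumes \<gamma>: "curve_in X {u..v} \<gamma>" and pq: "p \<in> {u..v}" "q \<in> {u..v}"
    and f: "lipschitz_map L X Y f" and vol: "volume_preserving n X Y f"
    and r: "r > 0" and L: "L \<ge> 1" and c: "c > 0" and K: "K > 0"
    and lower: "\<And>x. x \<in> mspace X \<Longrightarrow> ennreal (c * r ^ n) \<le> hausdorff_measure X n (mball_of X x r)"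
    and upper: "hausdorff_measure Y n (mball_of Y y ((L + 1) * r)) \<le> ennreal (K * ((L + 1) * r) ^ n)"
    and img: "\<And>s. s \<in> {u..v} \<Longrightarrow> f (\<gamma> s) \<in> mball_of Y y r"
    and M: "K * (L + 1) ^ n < c * real (Suc M)"
  shows "mdist X (\<gamma> p) (\<gamma> q) \<le> 2 * real M * r"
proof (rule ccontr)
  assume "\<not> ?thesis"
  then have long: "2 * r * real M < mdist X (\<gamma> p) (\<gamma> q)" by (simp add: ac_simps)
  have ms: "\<gamma> s \<in> mspace X" if "s \<in> {u..v}" for s using curve_in_mspace[OF \<gamma> that] .
  \<comment> \<open>The distance from \<open>\<gamma> p\<close> takes all values between 0 and
    \<open>h q\<close>, so the subcurve has points at the distances
    \<open>0, 2*r, ..., 2*M*r\<close>; these are the \<open>M + 1\<close> centres.\<close>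
  define h where "h t = mdist X (\<gamma> p) (\<gamma> t)" for t
  have "connected (h ` {u..v})"
    unfolding h_def using ms[OF pq(1)] curve_in_mdist_continuous[OF \<gamma>]
    by (intro connected_continuous_image) auto
  moreover have "h p \<in> h ` {u..v}" "h q \<in> h ` {u..v}" using pq by auto
  ultimately have "{h p..h q} \<subseteq> h ` {u..v}" by (rule connected_contains_Icc)
  moreover have "2 * r * real i \<in> {h p..h q}" if "i < Suc M" for i
  proof -
    have "2 * r * real i \<le> 2 * r * real M" using that r by (intro mult_left_mono) auto
    then have "2 * r * real i \<le> h q" using long unfolding h_def by linarith
    moreover have "h p \<le> 2 * r * real i" using r ms[OF pq(1)] by (simp add: h_def mdist_self)
    ultimately show ?thesis by simp
  qed
  ultimately have "\<exists>s. s \<in> {u..v} \<and> h s = 2 * r * real i" if "i < Suc M" for i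
    using that by (smt (verit) imageE subsetD)
  then obtain s where s: "\<And>i. i < Suc M \<Longrightarrow> s i \<in> {u..v}" "\<And>i. i < Suc M \<Longrightarrow> h (s i) = 2 * r * real i"
    by metis
  define B where "B i = mball_of X (\<gamma> (s i)) r" for i
  have B_open: "openin (mtopology_of X) (B i)" for i
    unfolding B_def by (rule openin_mball_of)
  have "disjoint_family_on B {..<Suc M}"
    unfolding disjoint_family_on_def
  proof (intro ballI impI)
    fix i j assume ij: "i \<in> {..<Suc M}" "j \<in> {..<Suc M}" "i \<noteq> j"
    \<comment> \<open>Distances from \<open>\<gamma> p\<close> that differ by at least
      \<open>2 * r\<close> force the centres to be that far apart, hence the balls of radius
      \<open>r\<close> to be disjoint.\<close>
    have "1 \<le> \<bar>real i - real j\<bar>" using ij(3) by linarith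
    then have "2 * r * 1 \<le> 2 * r * \<bar>real i - real j\<bar>" using r by (intro mult_left_mono) auto
    also have "\<dots> = \<bar>2 * r * (real i - real j)\<bar>" using r by (simp add: abs_mult)
    also have "\<dots> = \<bar>h (s i) - h (s j)\<bar>" using s(2) ij by (simp add: right_diff_distrib)
    also have "\<dots> \<le> mdist X (\<gamma> (s i)) (\<gamma> (s j))"
      unfolding h_def using s(1) ij pq by (intro mdist_triangle_abs ms) auto
    finally have far: "2 * r \<le> mdist X (\<gamma> (s i)) (\<gamma> (s j))" by simp
    show "B i \<inter> B j = {}"
    proof (rule ccontr)
      assume "B i \<inter> B j \<noteq> {}"
      then obtain z where "z \<in> B i" "z \<in> B j" by blast
      then show False
        using far mdist_triangle[of "\<gamma> (s i)" X z "\<gamma> (s j)"] by (simp add: B_def mdist_commute)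
    qed
  qed
  then have "(\<Sum>i<Suc M. hausdorff_measure X n (B i)) = hausdorff_measure X n (\<Union>i<Suc M. B i)"
    by (intro hausdorff_measure_disjoint_UN) (auto intro: B_open)
  also have "\<dots> = hausdorff_measure Y n (f ` (\<Union>i<Suc M. B i))"
  proof -
    have "(\<Union>i<Suc M. B i) \<in> hausdorff_sets X n"
      by (intro openin_hausdorff_sets openin_Union) (auto intro: B_open)
    then show ?thesis using vol by (simp add: volume_preserving_def)
  qed
  also have "\<dots> \<le> hausdorff_measure Y n (mball_of Y y ((L + 1) * r))"
  proof (rule hausdorff_measure_mono, rule image_subsetI)
    \<comment> \<open>The image of a centre is within \<open>r\<close> of \<open>y\<close> and that
      of the ball within \<open>L * r\<close> of the former; this is the origin of
      \<open>L + 1\<close>.\<close>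
    fix z assume "z \<in> (\<Union>i<Suc M. B i)"
    then obtain i where i: "i < Suc M" "z \<in> B i" by blast
    then have z: "z \<in> mspace X" "\<gamma> (s i) \<in> mspace X" "mdist X (\<gamma> (s i)) z < r" by (auto simp: B_def)
    have y: "y \<in> mspace Y" "mdist Y y (f (\<gamma> (s i))) < r" using img[OF s(1)[OF i(1)]] by auto
    have "mdist Y (f (\<gamma> (s i))) (f z) \<le> L * mdist X (\<gamma> (s i)) z" using lipschitz_mapD[OF f] z by blast
    also have "\<dots> \<le> L * r" using z(3) L by (intro mult_left_mono) auto
    finally have "mdist Y y (f z) < r + L * r"
      using y mdist_triangle[of y Y "f (\<gamma> (s i))" "f z"] lipschitz_mapD(1)[OF f] z by simp
    then show "f z \<in> mball_of Y y ((L + 1) * r)"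
      using y(1) lipschitz_mapD(1)[OF f z(1)] by (simp add: algebra_simps)
  qed
  also have "\<dots> \<le> ennreal (K * ((L + 1) * r) ^ n)" by (rule upper)
  finally have "(\<Sum>i<Suc M. hausdorff_measure X n (B i)) \<le> ennreal (K * ((L + 1) * r) ^ n)" .
  moreover have "(\<Sum>i<Suc M. ennreal (c * r ^ n)) \<le> (\<Sum>i<Suc M. hausdorff_measure X n (B i))"
    using lower s(1) ms unfolding B_def by (intro sum_mono) auto
  moreover have "(\<Sum>i<Suc M. ennreal (c * r ^ n)) = ennreal (real (Suc M) * (c * r ^ n))"
    using c r by (subst sum_ennreal) auto
  ultimately have "ennreal (real (Suc M) * (c * r ^ n)) \<le> ennreal (K * ((L + 1) * r) ^ n)"
    by (metis order_trans)
  then have "real (Suc M) * (c * r ^ n) \<le> K * ((L + 1) * r) ^ n"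
    using K L r by (subst (asm) ennreal_le_iff) auto
  then have "(c * real (Suc M)) * r ^ n \<le> (K * (L + 1) ^ n) * r ^ n"
    by (simp only: power_mult_distrib ac_simps)
  then have "c * real (Suc M) \<le> K * (L + 1) ^ n"
    using r by (subst (asm) mult_le_cancel_right_pos) auto
  then show False using M by linarith
qed

section \<open>From volume to length\<close>

text \<open>The image of a subcurve through \<open>t\<close> lies in any ball around
  \<open>f (\<gamma> t)\<close> whose radius exceeds its length. The packing bound is applied with
  such radii, which then decrease to the length.\<close>

lemma local_mdist_le_curve_length:
  fixes M :: nat
  assumes \<gamma>: "curve_in X I \<gamma>" and t: "t \<in> I"
    and f: "lipschitz_map L X Y f" and vol: "volume_preserving n X Y f"
    and L: "L \<ge> 1" and c: "c > 0" and K: "K > 0" and M: "K * (L + 1) ^ n < c * real (Suc M)" "M \<ge> 1"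
    and lower: "\<And>x r. x \<in> mspace X \<Longrightarrow> r > 0 \<Longrightarrow> ennreal r < ediam X (mspace X) \<Longrightarrow>
       ennreal (c * r ^ n) \<le> hausdorff_measure X n (mball_of X x r)"
    and thin: "f (\<gamma> t) \<notin> thick_set Y n K k"
  obtains \<delta> where "\<delta> > 0" "\<And>u v p q. {u..v} \<subseteq> I \<Longrightarrow> t \<in> {u..v} \<Longrightarrow> v - u < \<delta> \<Longrightarrow> p \<in> {u..v} \<Longrightarrow> q \<in> {u..v} \<Longrightarrow>
    ennreal (mdist X (\<gamma> p) (\<gamma> q)) \<le> ennreal (2 * real M) * curve_length Y {u..v} (f \<circ> \<gamma>)"
proof (cases "ediam X (mspace X) = 0")
  \<comment> \<open>With diameter zero no radius is admissible in \<open>lower\<close>, but all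
    distances vanish.\<close>
  case True
  have "ennreal (mdist X (\<gamma> p) (\<gamma> q)) = 0" if "p \<in> I" "q \<in> I" for p q
    using mdist_le_ediam[of "\<gamma> p" "mspace X" "\<gamma> q" X] curve_in_mspace[OF \<gamma>] that True by simp
  then show thesis
    by (intro that[of 1]) (auto simp: subset_iff)
next
  case False
  define y where "y = f (\<gamma> t)"
  have \<gamma>t: "\<gamma> t \<in> mspace X" by (rule curve_in_mspace[OF \<gamma> t])
  then have y: "y \<in> mspace Y" unfolding y_def by (rule lipschitz_mapD(1)[OF f])
  have "0 < ediam X (mspace X)" using False by (simp add: zero_less_iff_neq_zero)
  then obtain z where z: "0 < z" "z < ediam X (mspace X)"
    using dense by blast
  then obtain d where d: "0 < ennreal d" "ennreal d < ediam X (mspace X)"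
    by (cases z) auto
  \<comment> \<open>Radii up to \<open>r0\<close> are below the diameter of \<open>X\<close>, as
    \<open>lower\<close> requires, and \<open>(L + 1) * r0\<close> is below
    \<open>1 / (k + 1)\<close>, the range in which lying outside the thick set bounds the measure of
    balls.\<close>
  define r0 where "r0 = min d (1 / (2 * real (Suc k)) / (L + 1))"
  have r0: "r0 > 0" using d L unfolding r0_def by (auto simp: add_pos_nonneg)
  have upper: "hausdorff_measure Y n (mball_of Y y ((L + 1) * r)) \<le> ennreal (K * ((L + 1) * r) ^ n)"
    if "0 < r" "r \<le> r0" for r
  proof -
    have "r \<le> 1 / (2 * real (Suc k)) / (L + 1)" using that unfolding r0_def by linarith
    then have "(L + 1) * r \<le> 1 / (2 * real (Suc k))"
      using L by (simp add: pos_le_divide_eq mult.commute del: of_nat_Suc)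
    also have "\<dots> < 1 / real (Suc k)" by (intro divide_strict_left_mono) auto
    finally have "(L + 1) * r < 1 / real (Suc k)" .
    moreover have "0 < (L + 1) * r" using that L by simp
    moreover have "y \<in> mball_of Y y ((L + 1) * r)" using y \<open>0 < (L + 1) * r\<close> by (simp add: mdist_self)
    ultimately show ?thesis
      using thin y unfolding y_def thick_set_iff by (meson not_le)
  qed
  have lower': "ennreal (c * r ^ n) \<le> hausdorff_measure X n (mball_of X x r)"
    if "0 < r" "r \<le> r0" "x \<in> mspace X" for r x
  proof (rule lower[OF that(3,1)])
    have "ennreal r \<le> ennreal d" using that unfolding r0_def by (intro ennreal_leI) auto
    then show "ennreal r < ediam X (mspace X)" using d(2) by (rule le_less_trans)
  qed
  have "r0 / L > 0" using r0 L by simp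
  then obtain \<delta> where \<delta>: "\<delta> > 0" "\<And>s. s \<in> I \<Longrightarrow> \<bar>s - t\<bar> < \<delta> \<Longrightarrow> mdist X (\<gamma> t) (\<gamma> s) < r0 / L"
    using curve_in_continuity[OF \<gamma> t] by blast
  show thesis
  proof (rule that[OF \<delta>(1)])
    fix u v p q assume uv: "{u..v} \<subseteq> I" "t \<in> {u..v}" "v - u < \<delta>" and pq: "p \<in> {u..v}" "q \<in> {u..v}"
    let ?l = "curve_length Y {u..v} (f \<circ> \<gamma>)"
    show "ennreal (mdist X (\<gamma> p) (\<gamma> q)) \<le> ennreal (2 * real M) * ?l"
    proof (cases "?l = \<infinity>")
      case True
      then show ?thesis using M(2) by (simp add: ennreal_mult_top)
    next
      case False
      then obtain l where l: "l \<ge> 0" "?l = ennreal l"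
        by (metis ennreal_cases infinity_ennreal_def)
      \<comment> \<open>A strict bound, since \<open>l\<close> may be 0 while balls need positive
        radius. Truncating \<open>r\<close> at \<open>r0\<close> is harmless because the choice of
        \<open>\<delta>\<close> already keeps the image within \<open>r0\<close> of
        \<open>y\<close>.\<close>
      have *: "mdist X (\<gamma> p) (\<gamma> q) \<le> 2 * real M * r" if r: "l < r" for r
      proof -
        define r' where "r' = min r r0"
        have r': "0 < r'" "r' \<le> r0" "r' \<le> r" using r l(1) r0 by (auto simp: r'_def)
        have "f (\<gamma> s) \<in> mball_of Y y r'" if s: "s \<in> {u..v}" for s
        proof -
          have sI: "s \<in> I" "\<bar>s - t\<bar> < \<delta>" using s uv by auto
          have \<gamma>s: "\<gamma> s \<in> mspace X" by (rule curve_in_mspace[OF \<gamma> sI(1)])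
          have "mdist Y y (f (\<gamma> s)) \<le> L * mdist X (\<gamma> t) (\<gamma> s)"
            unfolding y_def using lipschitz_mapD(2)[OF f \<gamma>t \<gamma>s] .
          also have "\<dots> < L * (r0 / L)" using \<delta>(2)[OF sI] L by (intro mult_strict_left_mono) auto
          also have "\<dots> = r0" using L by simp
          finally have "mdist Y y (f (\<gamma> s)) < r0" .
          moreover have "mdist Y y (f (\<gamma> s)) \<le> l"
            using mdist_le_curve_length[of t "{u..v}" s Y "f \<circ> \<gamma>"] uv(2) s l by (simp add: y_def)
          ultimately show ?thesis
            using r y lipschitz_mapD(1)[OF f \<gamma>s] by (simp add: r'_def)
        qed
        then have "mdist X (\<gamma> p) (\<gamma> q) \<le> 2 * real M * r'"
          by (intro mdist_le_of_image_in_ball[OF curve_in_subinterval[OF \<gamma> uv(1)] pq f vol r'(1) L c K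
                lower'[OF r'(1,2)] upper[OF r'(1,2)] _ M(1)])
        also have "\<dots> \<le> 2 * real M * r" using r'(3) by (intro mult_left_mono) auto
        finally show ?thesis .
      qed
      have "mdist X (\<gamma> p) (\<gamma> q) \<le> 2 * real M * l"
      proof (rule field_le_epsilon)
        fix e :: real assume e: "e > 0"
        have "mdist X (\<gamma> p) (\<gamma> q) \<le> 2 * real M * (l + e / (2 * real M))"
          using e M(2) by (intro *) auto
        also have "\<dots> = 2 * real M * l + e" using M(2) by (simp add: distrib_left)
        finally show "mdist X (\<gamma> p) (\<gamma> q) \<le> 2 * real M * l + e" .
      qed
      then show ?thesis
        unfolding l(2) using l(1) by (subst ennreal_mult[symmetric]) (auto intro: ennreal_leI)
    qed
  qed
qed

text \<open>The local estimate holds at every parameter outside the preimage of the dense set, and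
  the remaining parameters are negligible after composing with a distance function. This bounds each
  chord by the image length over the same interval, and superadditivity sums the chords.\<close>

lemma curve_length_le_curve_length_image:
  fixes M :: nat
  assumes \<gamma>: "curve_in X I \<gamma>"
    and f: "lipschitz_map L X Y f" and vol: "volume_preserving n X Y f"
    and L: "L \<ge> 1" and c: "c > 0" and K: "K > 0" and M: "K * (L + 1) ^ n < c * real (Suc M)" "M \<ge> 1"
    and lower: "\<And>x r. x \<in> mspace X \<Longrightarrow> r > 0 \<Longrightarrow> ennreal r < ediam X (mspace X) \<Longrightarrow>
       ennreal (c * r ^ n) \<le> hausdorff_measure X n (mball_of X x r)"
    and null: "hausdorff_measure X 1 (\<gamma> ` I \<inter> {x \<in> mspace X. f x \<in> (\<Inter>k. thick_set Y n K k)}) = 0"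
  shows "curve_length X I \<gamma> \<le> ennreal (2 * real M) * curve_length Y I (f \<circ> \<gamma>)"
proof -
  define N where "N = {x \<in> mspace X. f x \<in> (\<Inter>k. thick_set Y n K k)}"
  define \<Lambda> where "\<Lambda> u v = ennreal (2 * real M) * curve_length Y {u..v} (f \<circ> \<gamma>)" for u v
  have \<Lambda>: "\<Lambda> u v + \<Lambda> v w \<le> \<Lambda> u w" if "u \<le> v" "v \<le> w" for u v w
    using curve_length_superadditive[OF that, of Y "f \<circ> \<gamma>"]
    unfolding \<Lambda>_def distrib_left[symmetric] by (rule mult_left_mono) simp
  have step: "ennreal (mdist X (\<gamma> a) (\<gamma> b)) \<le> \<Lambda> a b" if ab: "a \<le> b" "{a..b} \<subseteq> I" for a b
  proof -
    have \<gamma>': "curve_in X {a..b} \<gamma>" by (rule curve_in_subinterval[OF \<gamma> ab(2)])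
    have \<gamma>a: "\<gamma> a \<in> mspace X" using curve_in_mspace[OF \<gamma>'] ab(1) by simp
    \<comment> \<open>Since \<open>g a = 0\<close>, the increment of \<open>g\<close> over
      \<open>{a..b}\<close> is the chord length, which reduces the claim to a real-valued
      function.\<close>
    define g where "g s = mdist X (\<gamma> a) (\<gamma> s)" for s
    define S where "S = {s \<in> {a..b}. \<gamma> s \<notin> N}"
    have "ennreal \<bar>g b - g a\<bar> \<le> \<Lambda> a b"
    proof (rule increment_le_superadditive[OF ab(1) _ \<Lambda>, where S = S])
      show "continuous_on {a..b} g"
        unfolding g_def by (rule curve_in_mdist_continuous[OF \<gamma>' \<gamma>a])
      show "S \<subseteq> {a..b}" by (auto simp: S_def)
      \<comment> \<open>\<open>g\<close> factors through \<open>\<gamma>\<close>, so the bad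
        parameters are mapped into the 1-Lipschitz image of a set of \<open>\<H>\<^sup>1\<close>
        measure zero.\<close>
      have "negligible ((\<lambda>x. mdist X (\<gamma> a) x) ` (\<gamma> ` I \<inter> N))"
      proof (rule negligible_image_hausdorff_null[where X = X])
        show "hausdorff_measure X 1 (\<gamma> ` I \<inter> N) = 0" using null unfolding N_def .
        show "\<bar>mdist X (\<gamma> a) x - mdist X (\<gamma> a) y\<bar> \<le> mdist X x y"
          if "x \<in> mspace X" "y \<in> mspace X" for x y
          by (rule mdist_triangle_abs[OF \<gamma>a that])
      qed
      then show "negligible (g ` ({a..b} - S))"
        by (rule negligible_subset) (use ab(2) in \<open>auto simp: g_def S_def\<close>)
      fix t assume t: "t \<in> S"
      then have tab: "t \<in> {a..b}" and tN: "\<gamma> t \<notin> N" by (auto simp: S_def)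
      then obtain k where k: "f (\<gamma> t) \<notin> thick_set Y n K k"
        using curve_in_mspace[OF \<gamma>' tab] by (auto simp: N_def)
      obtain \<delta> where \<delta>: "\<delta> > 0" "\<And>u v p q. {u..v} \<subseteq> {a..b} \<Longrightarrow> t \<in> {u..v} \<Longrightarrow> v - u < \<delta> \<Longrightarrow>
          p \<in> {u..v} \<Longrightarrow> q \<in> {u..v} \<Longrightarrow> ennreal (mdist X (\<gamma> p) (\<gamma> q)) \<le> \<Lambda> u v"
        unfolding \<Lambda>_def
        by (rule local_mdist_le_curve_length[OF \<gamma>' tab f vol L c K M lower k]) blast+
      show "\<exists>\<delta>>0. \<forall>u v. a \<le> u \<and> u \<le> t \<and> t \<le> v \<and> v \<le> b \<and> v - u < \<delta> \<longrightarrow>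
          (\<forall>p\<in>{u..v}. \<forall>q\<in>{u..v}. ennreal \<bar>g p - g q\<bar> \<le> \<Lambda> u v)"
      proof (intro exI[of _ \<delta>] conjI allI impI ballI)
        fix u v p q
        assume uv: "a \<le> u \<and> u \<le> t \<and> t \<le> v \<and> v \<le> b \<and> v - u < \<delta>" and pq: "p \<in> {u..v}" "q \<in> {u..v}"
        have "p \<in> {a..b}" "q \<in> {a..b}" using uv pq by auto
        then have "\<bar>g p - g q\<bar> \<le> mdist X (\<gamma> p) (\<gamma> q)"
          unfolding g_def using curve_in_mspace[OF \<gamma>'] by (intro mdist_triangle_abs \<gamma>a)
        then have "ennreal \<bar>g p - g q\<bar> \<le> ennreal (mdist X (\<gamma> p) (\<gamma> q))" by (rule ennreal_leI)
        also have "\<dots> \<le> \<Lambda> u v" using uv pq by (intro \<delta>(2)) auto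
        finally show "ennreal \<bar>g p - g q\<bar> \<le> \<Lambda> u v" .
      qed (fact \<delta>(1))
    qed
    then show ?thesis using \<gamma>a by (simp add: g_def mdist_self)
  qed
  show ?thesis
    unfolding curve_length_alt[of X]
  proof (rule SUP_least)
    fix ts assume "ts \<in> {ts. sorted ts \<and> set ts \<subseteq> I}"
    then have ts: "sorted ts" "set ts \<subseteq> I" by auto
    have iv: "{a..b} \<subseteq> I" if "a \<in> I" "b \<in> I" for a b
      using \<gamma> that mem_is_interval_1_I[of I a b] by (auto simp: curve_in_def)
    define m where "m = length ts - 1"
    have sub: "ts ! i \<in> I" if "i \<le> m" "ts \<noteq> []" for i
      using that ts(2) by (intro subsetD[OF ts(2)] nth_mem) (cases ts, auto simp: m_def)
    show "polygonal_length X \<gamma> ts \<le> ennreal (2 * real M) * curve_length Y I (f \<circ> \<gamma>)"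
    proof (cases "ts = []")
      case False
      have le: "ts ! i \<le> ts ! Suc i" if "i < m" for i
        using that ts(1) by (intro sorted_nth_mono) (auto simp: m_def)
      have "polygonal_length X \<gamma> ts \<le> (\<Sum>i<m. \<Lambda> (ts ! i) (ts ! Suc i))"
        unfolding polygonal_length_def m_def[symmetric]
      proof (rule sum_mono)
        fix i assume "i \<in> {..<m}"
        then have i: "i < m" by simp
        then have "ts ! i \<in> I" "ts ! Suc i \<in> I" by (auto intro!: sub False)
        then have "{ts ! i..ts ! Suc i} \<subseteq> I" by (rule iv)
        with le[OF i] show "ennreal (mdist X (\<gamma> (ts ! i)) (\<gamma> (ts ! Suc i))) \<le> \<Lambda> (ts ! i) (ts ! Suc i)"
          by (intro step)
      qed
      also have "\<dots> \<le> \<Lambda> (ts ! 0) (ts ! m)"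
      proof (rule superadditive_sum_le[where \<Lambda> = \<Lambda> and m = m and t = "\<lambda>i. ts ! i"])
        show "\<Lambda> u v + \<Lambda> v w \<le> \<Lambda> u w" if "u \<le> v" "v \<le> w" for u v w by (rule \<Lambda>[OF that])
        show "ts ! i \<le> ts ! Suc i" if "i < m" for i by (rule le[OF that])
      qed
      also have "\<dots> \<le> ennreal (2 * real M) * curve_length Y I (f \<circ> \<gamma>)"
        unfolding \<Lambda>_def
      proof (rule mult_left_mono)
        have "ts ! 0 \<in> I" "ts ! m \<in> I" by (rule sub; simp add: False)+
        then show "curve_length Y {ts ! 0..ts ! m} (f \<circ> \<gamma>) \<le> curve_length Y I (f \<circ> \<gamma>)"
          by (intro curve_length_mono iv)
      qed simp
      finally show ?thesis .
    qed simp
  qed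
qed

section \<open>The upper bound and the exceptional set\<close>

lemma curve_length_image_le:
  assumes \<gamma>: "curve_in X I \<gamma>" and f: "lipschitz_map L X Y f" and L: "L \<ge> 0"
  shows "curve_length Y I (f \<circ> \<gamma>) \<le> ennreal L * curve_length X I \<gamma>"
  unfolding curve_length_alt[of Y]
proof (rule SUP_least)
  fix ts assume "ts \<in> {ts. sorted ts \<and> set ts \<subseteq> I}"
  then have ts: "sorted ts" "set ts \<subseteq> I" by auto
  have ms: "\<gamma> (ts ! i) \<in> mspace X" if "i < length ts" for i
    using that ts(2) curve_in_mspace[OF \<gamma>] by (meson nth_mem subsetD)
  have "polygonal_length Y (f \<circ> \<gamma>) ts \<le> (\<Sum>i<length ts - 1. ennreal L * ennreal (mdist X (\<gamma> (ts ! i)) (\<gamma> (ts ! Suc i))))"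
    unfolding polygonal_length_def
  proof (rule sum_mono)
    fix i assume "i \<in> {..<length ts - 1}"
    then have "\<gamma> (ts ! i) \<in> mspace X" "\<gamma> (ts ! Suc i) \<in> mspace X" by (auto intro: ms)
    then show "ennreal (mdist Y ((f \<circ> \<gamma>) (ts ! i)) ((f \<circ> \<gamma>) (ts ! Suc i)))
        \<le> ennreal L * ennreal (mdist X (\<gamma> (ts ! i)) (\<gamma> (ts ! Suc i)))"
      using lipschitz_mapD(2)[OF f] L by (simp add: ennreal_mult[symmetric] ennreal_leI)
  qed
  also have "\<dots> = ennreal L * polygonal_length X \<gamma> ts"
    unfolding polygonal_length_def sum_distrib_left ..
  also have "\<dots> \<le> ennreal L * curve_length X I \<gamma>"
    using ts by (intro mult_left_mono polygonal_length_le_curve_length) auto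
  finally show "polygonal_length Y (f \<circ> \<gamma>) ts \<le> ennreal L * curve_length X I \<gamma>" .
qed

text \<open>Makes the preimages of the thick sets measurable, so that volume preservation can be
  applied to their intersection.\<close>

lemma lipschitz_preimage_open:
  assumes f: "lipschitz_map L X Y f" and L: "L > 0" and U: "openin (mtopology_of Y) U"
  shows "openin (mtopology_of X) {x \<in> mspace X. f x \<in> U}"
  unfolding openin_mtopology_of
proof (intro conjI ballI)
  fix x assume x: "x \<in> {x \<in> mspace X. f x \<in> U}"
  then obtain r where r: "r > 0" "mball_of Y (f x) r \<subseteq> U"
    using U by (auto simp: openin_mtopology_of)
  have "z \<in> {x \<in> mspace X. f x \<in> U}" if z: "z \<in> mball_of X x (r / L)" for z
  proof -
    have m: "x \<in> mspace X" "z \<in> mspace X" "mdist X x z < r / L" using z by auto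
    have "mdist Y (f x) (f z) \<le> L * mdist X x z" by (rule lipschitz_mapD(2)[OF f m(1,2)])
    also have "\<dots> < r" using m(3) L by (simp add: field_simps)
    finally have "f z \<in> mball_of Y (f x) r" using lipschitz_mapD(1)[OF f] m by simp
    then show ?thesis using r m by blast
  qed
  then show "\<exists>r>0. mball_of X x r \<subseteq> {x \<in> mspace X. f x \<in> U}"
    using r L by (intro exI[of _ "r / L"]) auto
qed auto

theorem theorem1p6:
  fixes n :: nat and L c :: real
  assumes "n \<ge> 2" and "L \<ge> 1" and "c > 0"
  shows "\<exists>C::real. 0 < C \<and> C \<le> 1 \<and>
    (\<forall>(X :: 'a metric) (Y :: 'b metric) (f :: 'a \<Rightarrow> 'b).
       locally_finite_hausdorff X n \<longrightarrow>
       locally_finite_hausdorff Y n \<longrightarrow>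
       open_sigma_finite_hausdorff Y n \<longrightarrow>
       (\<forall>x\<in>mspace X. \<forall>r>0. ennreal r < ediam X (mspace X) \<longrightarrow>
          hausdorff_measure X n (mball_of X x r) \<ge> ennreal (c * r ^ n)) \<longrightarrow>
       lipschitz_map L X Y f \<longrightarrow>
       volume_preserving n X Y f \<longrightarrow>
       almost_every_curve X n (\<lambda>I \<gamma>.
         ennreal C * curve_length X I \<gamma> \<le> curve_length Y I (f \<circ> \<gamma>) \<and>
         curve_length Y I (f \<circ> \<gamma>) \<le> ennreal L * curve_length X I \<gamma>))"
proof -
  define K where "K = 2 * 5 ^ n * unit_ball_vol (real n)"
  have K: "K > 0" by (simp add: K_def)
  \<comment> \<open>Depends only on \<open>n\<close>, \<open>L\<close> and \<open>c\<close>. It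
    bounds the number of disjoint balls in the packing argument; the successor ensures
    \<open>M \<ge> 1\<close>, hence \<open>C \<le> 1\<close> below.\<close>
  define M where "M = Suc (nat \<lceil>K * (L + 1) ^ n / c\<rceil>)"
  have "K * (L + 1) ^ n / c \<le> real (nat \<lceil>K * (L + 1) ^ n / c\<rceil>)"
    by (rule real_nat_ceiling_ge)
  then have "K * (L + 1) ^ n / c < real (Suc M)" by (simp add: M_def)
  then have M: "K * (L + 1) ^ n < c * real (Suc M)" "M \<ge> 1"
    using assms(3) by (simp add: pos_divide_less_eq mult.commute del: of_nat_Suc) (simp add: M_def)
  define C where "C = 1 / (2 * real M)"
  have C: "0 < C" "C \<le> 1" using M(2) by (auto simp: C_def)
  have "almost_every_curve X n (\<lambda>I \<gamma>.
         ennreal C * curve_length X I \<gamma> \<le> curve_length Y I (f \<circ> \<gamma>) \<and>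
         curve_length Y I (f \<circ> \<gamma>) \<le> ennreal L * curve_length X I \<gamma>)"
    if Y: "open_sigma_finite_hausdorff Y n"
      and lower: "\<forall>x\<in>mspace X. \<forall>r>0. ennreal r < ediam X (mspace X) \<longrightarrow>
          hausdorff_measure X n (mball_of X x r) \<ge> ennreal (c * r ^ n)"
      and f: "lipschitz_map L X Y f" and vol: "volume_preserving n X Y f"
    for X :: "'a metric" and Y :: "'b metric" and f :: "'a \<Rightarrow> 'b"
  proof -
    define A where "A = {x \<in> mspace X. f x \<in> (\<Inter>k. thick_set Y n K k)}"
    \<comment> \<open>\<open>A\<close> is a countable intersection of open sets, hence measurable,
      and its measure equals that of its image, which lies in a null set of
      \<open>Y\<close>.\<close>
    have "{x \<in> mspace X. f x \<in> thick_set Y n K k} \<in> sets (hausdorff_space X n)" for k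
      using lipschitz_preimage_open[OF f _ openin_thick_set] assms(2) by (simp add: openin_hausdorff_sets)
    then have "(\<Inter>k. {x \<in> mspace X. f x \<in> thick_set Y n K k}) \<in> sets (hausdorff_space X n)"
      by (intro sets.countable_INT) auto
    also have "(\<Inter>k. {x \<in> mspace X. f x \<in> thick_set Y n K k}) = A" unfolding A_def by blast
    finally have "hausdorff_measure X n A = hausdorff_measure Y n (f ` A)"
      using vol by (simp add: volume_preserving_def)
    also have "\<dots> \<le> hausdorff_measure Y n (\<Inter>k. thick_set Y n K k)"
      by (rule hausdorff_measure_mono) (auto simp: A_def)
    also have "\<dots> = 0" unfolding K_def by (rule thick_set_null[OF Y])
    finally have A0: "hausdorff_measure X n A = 0" by simp
    have bounds: "ennreal C * curve_length X I \<gamma> \<le> curve_length Y I (f \<circ> \<gamma>)"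
      "curve_length Y I (f \<circ> \<gamma>) \<le> ennreal L * curve_length X I \<gamma>"
      if \<gamma>: "rectifiable_curve X I \<gamma>" and null: "hausdorff_measure X 1 (\<gamma> ` I \<inter> A) = 0" for I \<gamma>
    proof -
      have \<gamma>': "curve_in X I \<gamma>" using \<gamma> by (simp add: rectifiable_curve_def)
      show "curve_length Y I (f \<circ> \<gamma>) \<le> ennreal L * curve_length X I \<gamma>"
        using curve_length_image_le[OF \<gamma>' f] assms(2) by simp
      have "curve_length X I \<gamma> \<le> ennreal (2 * real M) * curve_length Y I (f \<circ> \<gamma>)"
        using lower null unfolding A_def
        by (intro curve_length_le_curve_length_image[OF \<gamma>' f vol assms(2,3) K M]) auto
      then have "ennreal C * curve_length X I \<gamma> \<le> ennreal C * (ennreal (2 * real M) * curve_length Y I (f \<circ> \<gamma>))"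
        by (intro mult_left_mono) auto
      also have "\<dots> = ennreal (C * (2 * real M)) * curve_length Y I (f \<circ> \<gamma>)"
        using C by (simp add: ennreal_mult mult.assoc)
      also have "C * (2 * real M) = 1" using M(2) by (simp add: C_def)
      finally show "ennreal C * curve_length X I \<gamma> \<le> curve_length Y I (f \<circ> \<gamma>)"
        by (simp only: ennreal_1 mult_1)
    qed
    \<comment> \<open>By contraposition of \<open>bounds\<close>, a rectifiable curve violating
      either inequality meets \<open>A\<close> in positive one-dimensional measure, so
      \<open>A\<close> is the required witness.\<close>
    show ?thesis
      unfolding almost_every_curve_def exceptional_def
    proof (intro exI[of _ A] conjI)
      show "A \<subseteq> mspace X" by (auto simp: A_def)
      show "hausdorff_measure X n A = 0" by (rule A0)
    qed (use bounds in \<open>auto simp: zero_less_iff_neq_zero\<close>)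
  qed
  then show ?thesis using C by blast
qed

end
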